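(* Let $G$ be a totally bounded topological group which is a dense subgroup of a compact topological group $H$, and let $\mathcal A$ be a $G$-algebra of subsets of $G$ all having the strong Baire property in $G$. For $D\in\mathrm{SBP}(H)$ let $\gamma(D)=D\cap G$, and let $\mathcal C$ be the smallest Boolean algebra of subsets of $H$ containing $\gamma^{-1}[\mathcal A^d]=\{D\in\mathrm{SBP}(H): D\cap G\in\mathcal A^d\}$ and closed under left and right translation by elements of $H$. For $x,y\in H$ put $x\sim_{\mathcal A}y$ iff for all $C\in\mathcal C$, $x\in\varrho(C)\Leftrightarrow y\in\varrho(C)$, where $\varrho(C)=\mathrm{int}(\mathrm{cl}(C))$ in $H$, and let $N_{\mathcal A}$ be the class of the identity (a normal subgroup of $H$). Then the Ellis group of $S(\mathcal A)$ is isomorphic to $H/N_{\mathcal A}$.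
   Context: $\mathrm{SBP}(X)$ denotes the family of subsets $A$ of a topological space $X$ with $\mathrm{int}(A)\cup\mathrm{int}(X\setminus A)$ dense (strong Baire property). A $G$-algebra of subsets of $G$ is closed under finite unions, complements and left translations by elements of $G$. For an ultrafilter $q$ on $\mathcal P(G)$, $d_q(A)=\{h\in G:h^{-1}A\in q\}$; $\mathcal A^d$ is the smallest $G$-algebra containing $\mathcal A$ closed under all $d_q$. $S(\mathcal A)$ is the Stone space of ultrafilters of $\mathcal A$ with action $g\cdot p=\{gA:A\in p\}$. The Ellis semigroup $E(X)$ of a compact $G$-space $X$ is the closure of $\{x\mapsto gx\}$ in $X^X$; for a minimal left ideal $I$ and idempotent $u\in I$, the group $uI$ has an isomorphism type independent of choices, the Ellis group of $X$. *)

theory Defs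
  imports "HOL-Analysis.Analysis" "HOL-Algebra.Coset"
begin

text \<open>
  Topological groups are groups in the sense of HOL-Algebra together with an abstract topology on
  the carrier. No separation axiom is built in.
\<close>

locale topological_group = group G for G (structure) +
  fixes T :: "'a topology"
  assumes topspace_eq: "topspace T = carrier G"
    and continuous_mult: "continuous_map (prod_topology T T) T (\<lambda>(x, y). x \<otimes> y)"
    and continuous_inv: "continuous_map T T (\<lambda>x. inv x)"

definition totally_bounded_group :: "('a, 'm) monoid_scheme \<Rightarrow> 'a topology \<Rightarrow> bool" where
  "totally_bounded_group G T \<longleftrightarrow> topological_group G T \<and>
     (\<forall>U. openin T U \<and> \<one>\<^bsub>G\<^esub> \<in> U \<longrightarrow>
        (\<exists>F. finite F \<and> F \<subseteq> carrier G \<and> (\<Union>f\<in>F. f <#\<^bsub>G\<^esub> U) = carrier G))"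

definition SBP :: "'a topology \<Rightarrow> 'a set set" where
  "SBP X = {A. A \<subseteq> topspace X \<and>
     X closure_of (X interior_of A \<union> X interior_of (topspace X - A)) = topspace X}"

text \<open>
  The name \<open>Sigma_Algebra.algebra\<close> (Boolean algebra of subsets) is qualified because
  HOL-Algebra also has a locale called \<open>algebra\<close>.
\<close>

definition G_algebra :: "('a, 'm) monoid_scheme \<Rightarrow> 'a set set \<Rightarrow> bool" where
  "G_algebra G \<A> \<longleftrightarrow> Sigma_Algebra.algebra (carrier G) \<A> \<and>
     (\<forall>g\<in>carrier G. \<forall>A\<in>\<A>. g <#\<^bsub>G\<^esub> A \<in> \<A>)"

text \<open>Ultrafilters of a Boolean algebra \<open>\<A>\<close> of subsets of \<open>\<Omega>\<close>.\<close>

definition set_ultrafilter :: "'a set \<Rightarrow> 'a set set \<Rightarrow> 'a set set \<Rightarrow> bool" where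
  "set_ultrafilter \<Omega> \<A> p \<longleftrightarrow> p \<subseteq> \<A> \<and> \<Omega> \<in> p \<and> {} \<notin> p \<and>
     (\<forall>A\<in>p. \<forall>B\<in>p. A \<inter> B \<in> p) \<and>
     (\<forall>A\<in>p. \<forall>B\<in>\<A>. A \<subseteq> B \<longrightarrow> B \<in> p) \<and>
     (\<forall>A\<in>\<A>. A \<in> p \<or> \<Omega> - A \<in> p)"

definition d_op :: "('a, 'm) monoid_scheme \<Rightarrow> 'a set set \<Rightarrow> 'a set \<Rightarrow> 'a set" where
  "d_op G q A = {h \<in> carrier G. (inv\<^bsub>G\<^esub> h) <#\<^bsub>G\<^esub> A \<in> q}"

definition d_closure :: "('a, 'm) monoid_scheme \<Rightarrow> 'a set set \<Rightarrow> 'a set set" where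
  "d_closure G \<A> = \<Inter> {\<B>. G_algebra G \<B> \<and> \<A> \<subseteq> \<B> \<and>
     (\<forall>q. set_ultrafilter (carrier G) (Pow (carrier G)) q \<longrightarrow> (\<forall>B\<in>\<B>. d_op G q B \<in> \<B>))}"

definition stone_space :: "'a set \<Rightarrow> 'a set set \<Rightarrow> 'a set set topology" where
  "stone_space \<Omega> \<A> =
     topology_generated_by ((\<lambda>A. {p. set_ultrafilter \<Omega> \<A> p \<and> A \<in> p}) ` \<A>)"

definition stone_action :: "('a, 'm) monoid_scheme \<Rightarrow> 'a \<Rightarrow> 'a set set \<Rightarrow> 'a set set" where
  "stone_action G g p = (\<lambda>A. g <#\<^bsub>G\<^esub> A) ` p"

text \<open>
  The Ellis semigroup of a space \<open>X\<close> with an action \<open>\<phi>\<close> of \<open>G\<close>. Elements of the product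
  of copies of \<open>X\<close> indexed by the points of \<open>X\<close> are functions that are \<open>undefined\<close> outside
  \<open>topspace X\<close>, hence \<open>restrict\<close> and \<open>compose\<close>. The semigroup is a monoid, the identity map
  being the translation by the neutral element of \<open>G\<close>.
\<close>

definition ellis_semigroup ::
  "('g, 'm) monoid_scheme \<Rightarrow> 'x topology \<Rightarrow> ('g \<Rightarrow> 'x \<Rightarrow> 'x) \<Rightarrow> ('x \<Rightarrow> 'x) monoid" where
  "ellis_semigroup G X \<phi> =
     \<lparr>carrier = product_topology (\<lambda>_. X) (topspace X) closure_of
                  ((\<lambda>g. restrict (\<phi> g) (topspace X)) ` carrier G),
      mult = compose (topspace X),
      one = restrict id (topspace X)\<rparr>"

definition left_ideal :: "('e, 'm) monoid_scheme \<Rightarrow> 'e set \<Rightarrow> bool" where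
  "left_ideal S I \<longleftrightarrow> I \<noteq> {} \<and> I \<subseteq> carrier S \<and> (\<forall>s\<in>carrier S. \<forall>i\<in>I. s \<otimes>\<^bsub>S\<^esub> i \<in> I)"

definition minimal_left_ideal :: "('e, 'm) monoid_scheme \<Rightarrow> 'e set \<Rightarrow> bool" where
  "minimal_left_ideal S I \<longleftrightarrow> left_ideal S I \<and> (\<forall>J. left_ideal S J \<and> J \<subseteq> I \<longrightarrow> J = I)"

definition idempotent_in :: "('e, 'm) monoid_scheme \<Rightarrow> 'e set \<Rightarrow> 'e \<Rightarrow> bool" where
  "idempotent_in S I u \<longleftrightarrow> u \<in> I \<and> u \<otimes>\<^bsub>S\<^esub> u = u"

definition ellis_group :: "('e, 'm) monoid_scheme \<Rightarrow> 'e set \<Rightarrow> 'e \<Rightarrow> 'e monoid" where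
  "ellis_group S I u = \<lparr>carrier = u <#\<^bsub>S\<^esub> I, mult = mult S, one = u\<rparr>"

definition rho :: "'a topology \<Rightarrow> 'a set \<Rightarrow> 'a set" where
  "rho X C = X interior_of (X closure_of C)"

text \<open>
  In the following three definitions \<open>T\<close> is the topology of the group \<open>H\<close>, \<open>G\<close> is the carrier
  of the dense subgroup, and \<open>\<A>\<close> is an algebra of subsets of \<open>G\<close>.
\<close>

definition C_algebra ::
  "('a, 'm) monoid_scheme \<Rightarrow> 'a topology \<Rightarrow> 'a set \<Rightarrow> 'a set set \<Rightarrow> 'a set set" where
  "C_algebra H T G \<A> = \<Inter> {\<B>. Sigma_Algebra.algebra (carrier H) \<B> \<and>
     {D \<in> SBP T. D \<inter> G \<in> d_closure (H\<lparr>carrier := G\<rparr>) \<A>} \<subseteq> \<B> \<and>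
     (\<forall>h\<in>carrier H. \<forall>C\<in>\<B>. h <#\<^bsub>H\<^esub> C \<in> \<B> \<and> C #>\<^bsub>H\<^esub> h \<in> \<B>)}"

definition sim_rel ::
  "('a, 'm) monoid_scheme \<Rightarrow> 'a topology \<Rightarrow> 'a set \<Rightarrow> 'a set set \<Rightarrow> 'a \<Rightarrow> 'a \<Rightarrow> bool" where
  "sim_rel H T G \<A> x y \<longleftrightarrow> (\<forall>C\<in>C_algebra H T G \<A>. x \<in> rho T C \<longleftrightarrow> y \<in> rho T C)"

definition N_sub ::
  "('a, 'm) monoid_scheme \<Rightarrow> 'a topology \<Rightarrow> 'a set \<Rightarrow> 'a set set \<Rightarrow> 'a set" where
  "N_sub H T G \<A> = {x \<in> carrier H. sim_rel H T G \<A> x \<one>\<^bsub>H\<^esub>}"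

end

theory Submission
  imports Defs
begin

text \<open>
  Every element of the Ellis semigroup of \<open>S(\<A>)\<close> is the map \<open>p \<mapsto> q \<cdot> p\<close> of an ultrafilter
  \<open>q\<close> on \<open>G\<close>, and every ultrafilter on \<open>G\<close> converges in \<open>H\<close>. If \<open>r\<close> converges to \<open>y\<close>,
  then \<open>d\<^sub>r\<close> preserves the strong Baire property and \<open>\<rho>(d\<^sub>r A) = \<rho>(A) y\<^sup>-\<^sup>1\<close>. Call \<open>q\<close> generic if it
  contains no nowhere dense set; then \<open>A \<in> q\<close> depends only on \<open>\<rho>(A)\<close>, so that \<open>q \<cdot> r\<close> depends
  only on \<open>q\<close> and the limit of \<open>r\<close>. Hence the maps of generic ultrafilters form a left ideal that
  is contained in every left ideal, and for an idempotent \<open>u\<close> given by a generic \<open>q\<close>,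
  \<open>x \<mapsto> q \<cdot> r\<close> with \<open>r\<close> converging to \<open>x\<close> is a homomorphism of \<open>H\<close> onto the Ellis group.
  Its kernel is \<open>N\<^sub>\<A>\<close>: elements of \<open>N\<^sub>\<A>\<close> fix all \<open>\<rho>(A) y\<close> under right translation, and an
  element \<open>s\<close> of the kernel fixes all \<open>\<rho>(A)\<close>, since otherwise some translate of \<open>q\<close> would contain
  the nonempty open set \<open>\<rho>(A) s\<close> minus the closure of \<open>\<rho>(A)\<close>. The sets with kernel-invariant
  \<open>\<rho>\<close> form an algebra that is closed under \<open>d\<^sub>q\<close> and translations and hence contains \<open>\<C>\<close>.
\<close>

section \<open>Ultrafilters\<close>

lemma ultrafilter_extends:
  assumes "\<S> \<subseteq> Pow \<Omega>" "\<S> \<noteq> {}" "{} \<notin> \<S>" "\<And>A B. A \<in> \<S> \<Longrightarrow> B \<in> \<S> \<Longrightarrow> A \<inter> B \<in> \<S>"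
  obtains q where "set_ultrafilter \<Omega> (Pow \<Omega>) q" "\<S> \<subseteq> q"
proof -
  define P where
    "P = {M. \<S> \<subseteq> M \<and> M \<subseteq> Pow \<Omega> \<and> {} \<notin> M \<and> (\<forall>A\<in>M. \<forall>B\<in>M. A \<inter> B \<in> M)}"
  have "\<S> \<in> P"
    using assms by (auto simp: P_def)
  have "\<exists>M\<in>P. \<forall>X\<in>P. M \<subseteq> X \<longrightarrow> X = M"
  proof (rule subset_Zorn_nonempty)
    show "P \<noteq> {}"
      using \<open>\<S> \<in> P\<close> by blast
    fix C assume C: "C \<noteq> {}" "subset.chain P C"
    then have CP: "C \<subseteq> P" and tot: "\<And>X Y. X \<in> C \<Longrightarrow> Y \<in> C \<Longrightarrow> X \<subseteq> Y \<or> Y \<subseteq> X"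
      by (auto simp: subset_chain_def)
    have "A \<inter> B \<in> \<Union>C" if XY: "A \<in> X" "X \<in> C" "B \<in> Y" "Y \<in> C" for A B X Y
    proof -
      obtain Z where "Z \<in> C" "A \<in> Z" "B \<in> Z"
        using tot[of X Y] XY by blast
      then show ?thesis
        using CP by (auto simp: P_def)
    qed
    then have "\<forall>A\<in>\<Union>C. \<forall>B\<in>\<Union>C. A \<inter> B \<in> \<Union>C"
      by (meson UnionE)
    moreover have mem: "\<S> \<subseteq> M" "M \<subseteq> Pow \<Omega>" "{} \<notin> M" if "M \<in> C" for M
      using subsetD[OF CP that] by (simp_all add: P_def)
    have "\<Union>C \<subseteq> Pow \<Omega>"
      by (rule Union_least) (rule mem)
    moreover have "{} \<notin> \<Union>C"
      using mem(3) by (meson UnionE)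
    moreover obtain M where "M \<in> C"
      using C(1) by (meson ex_in_conv)
    then have "\<S> \<subseteq> \<Union>C"
      by (meson Union_upper mem(1) subset_trans)
    ultimately show "\<Union>C \<in> P"
      by (simp add: P_def)
  qed
  then obtain M where "M \<in> P" and max: "\<And>X. X \<in> P \<Longrightarrow> M \<subseteq> X \<Longrightarrow> X = M"
    by blast
  then have M: "\<S> \<subseteq> M" "M \<subseteq> Pow \<Omega>" "{} \<notin> M" "\<And>A B. A \<in> M \<Longrightarrow> B \<in> M \<Longrightarrow> A \<inter> B \<in> M"
    by (auto simp: P_def)
  \<comment> \<open>If \<open>A\<close> meets every member of \<open>M\<close>, the filter generated
    by \<open>M\<close> and \<open>A\<close> belongs to \<open>P\<close> again, so maximality makes
    it equal to \<open>M\<close>.\<close>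
  have ext: "{C. C \<subseteq> \<Omega> \<and> (\<exists>B\<in>M. A \<inter> B \<subseteq> C)} = M" if "\<And>B. B \<in> M \<Longrightarrow> A \<inter> B \<noteq> {}" for A
  proof (rule max)
    let ?X = "{C. C \<subseteq> \<Omega> \<and> (\<exists>B\<in>M. A \<inter> B \<subseteq> C)}"
    show MX: "M \<subseteq> ?X"
      using M(2) by blast
    have "?X \<subseteq> Pow \<Omega>"
      by blast
    moreover have "C \<inter> D \<in> ?X" if CD: "C \<in> ?X" "D \<in> ?X" for C D
    proof -
      obtain B B' where "B \<in> M" "B' \<in> M" "A \<inter> B \<subseteq> C" "A \<inter> B' \<subseteq> D"
        using CD by blast
      then have "B \<inter> B' \<in> M" "A \<inter> (B \<inter> B') \<subseteq> C \<inter> D"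
        using M(4) by auto
      then show ?thesis
        using that by blast
    qed
    moreover have "{} \<notin> ?X"
      using that by blast
    ultimately show "?X \<in> P"
      using subset_trans[OF M(1) MX] by (simp add: P_def)
  qed
  have memI: "C \<in> M" if "\<And>B. B \<in> M \<Longrightarrow> A \<inter> B \<noteq> {}" "C \<subseteq> \<Omega>" "B \<in> M" "A \<inter> B \<subseteq> C" for A B C
  proof -
    have "C \<in> {C. C \<subseteq> \<Omega> \<and> (\<exists>B\<in>M. A \<inter> B \<subseteq> C)}"
      using that(2-4) by blast
    then show ?thesis
      by (simp only: ext[OF that(1)])
  qed
  \<comment> \<open>Membership in \<open>P\<close> does not include upward closure; for the maximal
    \<open>M\<close> it is the case of \<open>memI\<close> where the added set is
    \<open>\<Omega>\<close>.\<close>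
  have up: "C \<in> M" if "C \<subseteq> \<Omega>" "B \<in> M" "B \<subseteq> C" for B C
  proof (rule memI[of \<Omega>])
    show "\<Omega> \<inter> B' \<noteq> {}" if "B' \<in> M" for B'
      using that M(2,3) by (metis PowD inf.absorb_iff2 subsetD)
  qed (use that in auto)
  obtain B0 where B0: "B0 \<in> M"
    using assms(2) M(1) by (meson ex_in_conv subsetD)
  have dich: "A \<in> M \<or> \<Omega> - A \<in> M" if A: "A \<subseteq> \<Omega>" for A
  proof (cases "\<exists>B\<in>M. A \<inter> B = {}")
    case True
    then obtain B where B: "B \<in> M" "A \<inter> B = {}"
      by (elim bexE)
    then have "B \<subseteq> \<Omega> - A"
      using M(2) by auto
    then show ?thesis
      using up[of "\<Omega> - A" B] B(1) by simp
  next
    case False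
    then show ?thesis
      using A B0 by (intro disjI1 memI[of A A B0]) auto
  qed
  have "\<Omega> \<in> M"
    using up[of \<Omega> B0] B0 M(2) by (meson PowD subsetD subset_refl)
  then have "set_ultrafilter \<Omega> (Pow \<Omega>) M"
    unfolding set_ultrafilter_def
    by (intro conjI ballI impI M(2-4)) (assumption | rule up dich | erule PowD)+
  then show ?thesis
    using that M(1) by simp
qed

lemma set_ultrafilterD:
  assumes "set_ultrafilter \<Omega> \<A> p"
  shows "p \<subseteq> \<A>" "\<Omega> \<in> p" "{} \<notin> p"
    and "A \<in> p \<Longrightarrow> B \<in> p \<Longrightarrow> A \<inter> B \<in> p"
    and "A \<in> p \<Longrightarrow> B \<in> \<A> \<Longrightarrow> A \<subseteq> B \<Longrightarrow> B \<in> p"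
    and "A \<in> \<A> \<Longrightarrow> A \<notin> p \<Longrightarrow> \<Omega> - A \<in> p"
  using assms by (simp_all add: set_ultrafilter_def) metis

text \<open>A set of \<open>p'\<close> missing from \<open>p\<close> would have its complement in
  \<open>p\<close>, hence in \<open>p'\<close>. Equality of two points of the Stone space thus needs
  only one inclusion.\<close>

lemma ultrafilter_maximal:
  assumes p: "set_ultrafilter \<Omega> \<A> p" and p': "set_ultrafilter \<Omega> \<A> p'" and "p \<subseteq> p'"
  shows "p = p'"
proof (rule subset_antisym)
  show "p' \<subseteq> p"
  proof
    fix A assume A: "A \<in> p'"
    show "A \<in> p"
    proof (rule ccontr)
      assume "A \<notin> p"
      then have "\<Omega> - A \<in> p'"
        using set_ultrafilterD(6)[OF p, of A] set_ultrafilterD(1)[OF p'] A \<open>p \<subseteq> p'\<close> by auto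
      from set_ultrafilterD(4)[OF p' A this] show False
        using set_ultrafilterD(3)[OF p'] by simp
    qed
  qed
qed fact

lemma ultrafilter_mono:
  assumes "set_ultrafilter \<Omega> (Pow \<Omega>) q" "A \<in> q" "A \<subseteq> B" "B \<subseteq> \<Omega>"
  shows "B \<in> q"
  using assms unfolding set_ultrafilter_def by blast

lemma ultrafilter_Int_iff:
  assumes "set_ultrafilter \<Omega> (Pow \<Omega>) q" "A \<subseteq> \<Omega>" "B \<subseteq> \<Omega>"
  shows "A \<inter> B \<in> q \<longleftrightarrow> A \<in> q \<and> B \<in> q"
  using assms ultrafilter_mono[OF assms(1), of "A \<inter> B"] unfolding set_ultrafilter_def by blast

lemma ultrafilter_compl_iff:
  assumes "set_ultrafilter \<Omega> (Pow \<Omega>) q" "A \<subseteq> \<Omega>"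
  shows "\<Omega> - A \<in> q \<longleftrightarrow> A \<notin> q"
  using assms unfolding set_ultrafilter_def
  by (metis Diff_disjoint PowI)

lemma ultrafilter_disjoint:
  assumes "set_ultrafilter \<Omega> (Pow \<Omega>) q" "A \<in> q" "B \<in> q"
  shows "A \<inter> B \<noteq> {}"
  using assms unfolding set_ultrafilter_def by metis

lemma ultrafilter_finite_Union:
  assumes q: "set_ultrafilter \<Omega> (Pow \<Omega>) q"
    and "finite \<F>" "\<And>A. A \<in> \<F> \<Longrightarrow> A \<subseteq> \<Omega>" "\<Union>\<F> \<in> q"
  shows "\<exists>A\<in>\<F>. A \<in> q"
  using assms(2-)
proof (induction rule: finite_induct)
  case empty
  then show ?case
    using q by (simp add: set_ultrafilter_def)
next
  case (insert A \<F>)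
  show ?case
  proof (rule ccontr)
    assume neg: "\<not> ?case"
    then have "\<Omega> - A \<in> q" "\<Omega> - \<Union>\<F> \<in> q"
      using insert ultrafilter_compl_iff[OF q, of A] ultrafilter_compl_iff[OF q, of "\<Union>\<F>"] by auto
    then have "(\<Omega> - A) \<inter> (\<Omega> - \<Union>\<F>) \<in> q"
      using q by (simp add: set_ultrafilter_def)
    from ultrafilter_disjoint[OF q this insert.prems(2)] show False
      by auto
  qed
qed

lemma set_ultrafilter_restrict:
  assumes "set_ultrafilter \<Omega> (Pow \<Omega>) q" "Sigma_Algebra.algebra \<Omega> \<A>"
  shows "set_ultrafilter \<Omega> \<A> (\<A> \<inter> q)"
proof -
  interpret Sigma_Algebra.algebra \<Omega> \<A> by fact
  show ?thesis
    unfolding set_ultrafilter_def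
    using set_ultrafilterD(2-4)[OF assms(1)] sets_into_space ultrafilter_mono[OF assms(1)]
      ultrafilter_compl_iff[OF assms(1)] by auto
qed

text \<open>An ultrafilter of \<open>\<A>\<close> has the finite intersection property, so it lies
  in an ultrafilter \<open>q\<close> of the full power set. A member of \<open>\<A>\<close> outside
  \<open>p\<close> has its complement in \<open>p\<close>, so \<open>q\<close> adds nothing within
  \<open>\<A>\<close>. Points of the Stone space can therefore be handled as ultrafilters on the
  whole group.\<close>

lemma set_ultrafilter_extends:
  assumes p: "set_ultrafilter \<Omega> \<A> p" and "Sigma_Algebra.algebra \<Omega> \<A>"
  obtains q where "set_ultrafilter \<Omega> (Pow \<Omega>) q" "p = \<A> \<inter> q"
proof -
  interpret Sigma_Algebra.algebra \<Omega> \<A> by fact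
  obtain q where q: "set_ultrafilter \<Omega> (Pow \<Omega>) q" "p \<subseteq> q"
    using p space_closed by (elim ultrafilter_extends[of p \<Omega>, rotated -1]) (auto simp: set_ultrafilter_def)
  have "A \<in> p" if "A \<in> \<A>" "A \<in> q" for A
  proof (rule ccontr)
    assume "A \<notin> p"
    then have "\<Omega> - A \<in> q"
      using p q(2) that unfolding set_ultrafilter_def by blast
    then show False
      using ultrafilter_compl_iff[OF q(1), of A] that sets_into_space by blast
  qed
  then have "p = \<A> \<inter> q"
    using q(2) set_ultrafilterD(1)[OF p] by blast
  then show ?thesis
    using that q(1) by blast
qed

section \<open>The Ellis semigroup of a Stone space\<close>

lemma topspace_stone_space: "topspace (stone_space \<Omega> \<A>) = {p. set_ultrafilter \<Omega> \<A> p}"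
proof -
  have "\<exists>A\<in>\<A>. A \<in> p" if "set_ultrafilter \<Omega> \<A> p" for p
    using set_ultrafilterD(1,2)[OF that] by blast
  then show ?thesis
    by (auto simp: stone_space_def)
qed

lemma openin_stone_space_basic:
  "A \<in> \<A> \<Longrightarrow> openin (stone_space \<Omega> \<A>) {p. set_ultrafilter \<Omega> \<A> p \<and> A \<in> p}"
  unfolding stone_space_def by (rule topology_generated_by_Basis) blast

text \<open>The generating sets already form a base: for \<open>A\<close> and \<open>B\<close> in
  \<open>p\<close>, also \<open>A \<inter> B\<close> is in \<open>p\<close>, and its basic set lies
  inside those of \<open>A\<close> and \<open>B\<close>.\<close>

lemma stone_space_basic_nbhd:
  assumes "openin (stone_space \<Omega> \<A>) U" "p \<in> U"
  shows "\<exists>A\<in>p. {p'. set_ultrafilter \<Omega> \<A> p' \<and> A \<in> p'} \<subseteq> U"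
proof -
  have "generate_topology_on ((\<lambda>A. {p. set_ultrafilter \<Omega> \<A> p \<and> A \<in> p}) ` \<A>) U"
    using assms(1) by (simp add: stone_space_def openin_topology_generated_by_iff)
  moreover have "set_ultrafilter \<Omega> \<A> p"
    using openin_subset[OF assms(1)] assms(2) topspace_stone_space by blast
  ultimately show ?thesis
    using assms(2)
  proof (induction)
    case (Int a b)
    then obtain A B where AB: "A \<in> p" "{p'. set_ultrafilter \<Omega> \<A> p' \<and> A \<in> p'} \<subseteq> a"
      "B \<in> p" "{p'. set_ultrafilter \<Omega> \<A> p' \<and> B \<in> p'} \<subseteq> b"
      by blast
    then have "A \<inter> B \<in> p"
      using Int by (auto simp: set_ultrafilter_def)
    moreover have "A \<in> \<A>" "B \<in> \<A>"
      using AB Int.prems by (auto simp: set_ultrafilter_def)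
    then have "A \<in> p' \<and> B \<in> p'" if "set_ultrafilter \<Omega> \<A> p'" "A \<inter> B \<in> p'" for p'
      using set_ultrafilterD(5)[OF that(1,2)] \<open>A \<in> \<A>\<close> \<open>B \<in> \<A>\<close> by blast
    ultimately show ?case
      using AB by blast
  next
    case (UN K)
    then obtain k where "k \<in> K" "p \<in> k"
      by blast
    then show ?case
      using UN.IH[of k] UN.prems(1) by (meson Union_upper subset_trans)
  qed auto
qed

text \<open>The multiplication of the Stone-Cech compactification of the discrete group: the limit
  of the translates \<open>h \<cdot> r\<close> as \<open>h\<close> runs along
  \<open>q\<close>.\<close>

definition ultra_mult :: "('a, 'm) monoid_scheme \<Rightarrow> 'a set set \<Rightarrow> 'a set set \<Rightarrow> 'a set set" where
  "ultra_mult G q r = {A. A \<subseteq> carrier G \<and> d_op G r A \<in> q}"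

text \<open>The pointwise limit along \<open>q\<close> of the translations of the Stone space, since
  \<open>A \<in> g \<cdot> p\<close> means \<open>g \<in> d_op G p A\<close>. The restriction makes
  it a point of the product space that contains the Ellis semigroup.\<close>

definition ellis_map ::
  "('a, 'm) monoid_scheme \<Rightarrow> 'a set set \<Rightarrow> 'a set set \<Rightarrow> 'a set set \<Rightarrow> 'a set set" where
  "ellis_map G \<A> q =
     restrict (\<lambda>p. {A \<in> \<A>. d_op G p A \<in> q}) (topspace (stone_space (carrier G) \<A>))"

text \<open>Confines the test to points of the ambient set, where the criteria for membership in
  cosets apply.\<close>

lemma subset_eqI: "A \<subseteq> C \<Longrightarrow> B \<subseteq> C \<Longrightarrow> (\<And>x. x \<in> C \<Longrightarrow> x \<in> A \<longleftrightarrow> x \<in> B) \<Longrightarrow> A = B"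
  by blast

section \<open>Left translations, the operators \<open>d_op\<close> and products of ultrafilters on
  a group\<close>

context group
begin

lemma mem_l_coset_iff:
  assumes "g \<in> carrier G" "x \<in> carrier G" "A \<subseteq> carrier G"
  shows "x \<in> g <# A \<longleftrightarrow> inv g \<otimes> x \<in> A"
proof
  assume "x \<in> g <# A"
  then obtain a where "a \<in> A" "x = g \<otimes> a"
    by (auto simp: l_coset_def)
  then show "inv g \<otimes> x \<in> A"
    using assms by (simp add: subset_iff m_assoc[symmetric])
next
  assume "inv g \<otimes> x \<in> A"
  moreover have "x = g \<otimes> (inv g \<otimes> x)"
    using assms by (simp add: m_assoc[symmetric])
  ultimately show "x \<in> g <# A"
    unfolding l_coset_def by blast
qed

lemma l_coset_Int:
  assumes "g \<in> carrier G" "A \<subseteq> carrier G" "B \<subseteq> carrier G"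
  shows "g <# (A \<inter> B) = (g <# A) \<inter> (g <# B)"
proof (rule subset_eqI)
  have AB: "A \<inter> B \<subseteq> carrier G"
    using assms by blast
  then show "g <# (A \<inter> B) \<subseteq> carrier G"
    using assms l_coset_subset_G by blast
  show "(g <# A) \<inter> (g <# B) \<subseteq> carrier G"
    using assms l_coset_subset_G by blast
  show "x \<in> g <# (A \<inter> B) \<longleftrightarrow> x \<in> (g <# A) \<inter> (g <# B)" if "x \<in> carrier G" for x
    using mem_l_coset_iff[OF assms(1) that AB] mem_l_coset_iff[OF assms(1) that] assms by simp
qed

lemma l_coset_Diff:
  assumes "g \<in> carrier G" "A \<subseteq> carrier G"
  shows "g <# (carrier G - A) = carrier G - (g <# A)"
proof (rule subset_eqI)
  show "g <# (carrier G - A) \<subseteq> carrier G"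
    using assms l_coset_subset_G by blast
  show "x \<in> g <# (carrier G - A) \<longleftrightarrow> x \<in> carrier G - (g <# A)" if "x \<in> carrier G" for x
    using assms that by (simp add: mem_l_coset_iff)
qed simp

lemma l_coset_mono: "A \<subseteq> B \<Longrightarrow> g <# A \<subseteq> g <# B"
  by (auto simp: l_coset_def)

lemma d_op_subset [simp]: "d_op G q A \<subseteq> carrier G"
  by (auto simp: d_op_def)

lemma d_op_Int:
  assumes q: "set_ultrafilter (carrier G) (Pow (carrier G)) q"
    and "A \<subseteq> carrier G" "B \<subseteq> carrier G"
  shows "d_op G q (A \<inter> B) = d_op G q A \<inter> d_op G q B"
  using assms ultrafilter_Int_iff[OF q l_coset_subset_G l_coset_subset_G]
  by (auto simp: d_op_def l_coset_Int)

lemma d_op_compl: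
  assumes q: "set_ultrafilter (carrier G) (Pow (carrier G)) q" and "A \<subseteq> carrier G"
  shows "d_op G q (carrier G - A) = carrier G - d_op G q A"
  using assms ultrafilter_compl_iff[OF q l_coset_subset_G] by (auto simp: d_op_def l_coset_Diff)

lemma d_op_mono:
  assumes q: "set_ultrafilter (carrier G) (Pow (carrier G)) q" and "A \<subseteq> B" "B \<subseteq> carrier G"
  shows "d_op G q A \<subseteq> d_op G q B"
  using assms d_op_Int[OF q, of A B] by (metis Int_absorb2 inf.absorb_iff2 inf_commute subset_trans)

lemma d_op_l_coset:
  assumes "g \<in> carrier G" "A \<subseteq> carrier G"
  shows "d_op G q (g <# A) = g <# d_op G q A"
proof (rule subset_eqI)
  show "g <# d_op G q A \<subseteq> carrier G"
    using assms l_coset_subset_G d_op_subset by blast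
  show "h \<in> d_op G q (g <# A) \<longleftrightarrow> h \<in> g <# d_op G q A" if "h \<in> carrier G" for h
    using assms that by (simp add: mem_l_coset_iff) (simp add: d_op_def lcos_m_assoc inv_mult_group)
qed simp

text \<open>\<open>d_op G r\<close> preserves intersections and complements, so the product is the
  preimage of the ultrafilter \<open>q\<close> under a homomorphism of Boolean algebras.\<close>

lemma set_ultrafilter_ultra_mult:
  assumes q: "set_ultrafilter (carrier G) (Pow (carrier G)) q"
    and r: "set_ultrafilter (carrier G) (Pow (carrier G)) r"
  shows "set_ultrafilter (carrier G) (Pow (carrier G)) (ultra_mult G q r)"
proof -
  have car: "d_op G r (carrier G) = carrier G"
    using set_ultrafilterD(2)[OF r] l_coset_Diff[of _ "{}"] by (auto simp: d_op_def l_coset_def)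
  have emp: "d_op G r {} = {}"
    using d_op_compl[OF r, of "carrier G"] car by simp
  have int: "d_op G r (A \<inter> B) \<in> q" if "A \<subseteq> carrier G" "d_op G r A \<in> q" "B \<subseteq> carrier G" "d_op G r B \<in> q" for A B
    using that set_ultrafilterD(4)[OF q] by (simp add: d_op_Int[OF r])
  have mono: "d_op G r B \<in> q" if "d_op G r A \<in> q" "A \<subseteq> B" "B \<subseteq> carrier G" for A B
    using ultrafilter_mono[OF q that(1) d_op_mono[OF r that(2,3)] d_op_subset] .
  have compl: "d_op G r (carrier G - A) \<in> q" if "A \<subseteq> carrier G" "d_op G r A \<notin> q" for A
    using that ultrafilter_compl_iff[OF q d_op_subset] by (simp add: d_op_compl[OF r])
  show ?thesis
    unfolding set_ultrafilter_def ultra_mult_def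
  proof (intro conjI ballI impI)
    show "carrier G \<in> {A. A \<subseteq> carrier G \<and> d_op G r A \<in> q}"
      using set_ultrafilterD(2)[OF q] car by simp
    show "{} \<notin> {A. A \<subseteq> carrier G \<and> d_op G r A \<in> q}"
      using set_ultrafilterD(3)[OF q] emp by simp
  next
    fix A B
    assume "A \<in> {A. A \<subseteq> carrier G \<and> d_op G r A \<in> q}" "B \<in> Pow (carrier G)" "A \<subseteq> B"
    then show "B \<in> {A. A \<subseteq> carrier G \<and> d_op G r A \<in> q}"
      using mono[of A B] by simp
  qed (use int compl in auto)
qed

lemma mem_ultra_mult_iff: "A \<in> ultra_mult G q r \<longleftrightarrow> A \<subseteq> carrier G \<and> d_op G r A \<in> q"
  by (simp add: ultra_mult_def)

text \<open>By \<open>d_op_l_coset\<close> the operator of \<open>r\<close> commutes with left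
  translations, so the operators compose. Associativity of the product is a direct
  consequence.\<close>

lemma d_op_ultra_mult:
  assumes "A \<subseteq> carrier G"
  shows "d_op G (ultra_mult G q r) A = d_op G q (d_op G r A)"
  unfolding d_op_def[of G "ultra_mult G q r"] d_op_def[of G q]
  using assms by (simp add: ultra_mult_def l_coset_subset_G d_op_l_coset cong: conj_cong)

lemma ultra_mult_assoc:
  "ultra_mult G (ultra_mult G q r) s = ultra_mult G q (ultra_mult G r s)"
  by (rule Set.set_eqI) (simp add: mem_ultra_mult_iff d_op_ultra_mult cong: conj_cong)

end

section \<open>Maps of the Stone space given by ultrafilters on the group\<close>

locale group_algebra = group G for G (structure) +
  fixes \<A> :: "'a set set"
  assumes G_algebra: "G_algebra G \<A>"
begin

abbreviation "X \<equiv> stone_space (carrier G) \<A>"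

abbreviation "uf q \<equiv> set_ultrafilter (carrier G) (Pow (carrier G)) q"

abbreviation "E \<equiv> ellis_semigroup G X (stone_action G)"

sublocale Sigma_Algebra.algebra "carrier G" \<A>
  using G_algebra by (simp add: G_algebra_def)

lemma l_coset_closed: "g \<in> carrier G \<Longrightarrow> A \<in> \<A> \<Longrightarrow> g <# A \<in> \<A>"
  using G_algebra by (simp add: G_algebra_def)

lemma point_extends:
  assumes "p \<in> topspace X"
  obtains q where "uf q" "p = \<A> \<inter> q"
  using assms set_ultrafilter_extends algebra_axioms by (metis mem_Collect_eq topspace_stone_space)

lemma point_restrict: "uf q \<Longrightarrow> \<A> \<inter> q \<in> topspace X"
  by (simp add: topspace_stone_space set_ultrafilter_restrict algebra_axioms)

lemma d_op_restrict: "A \<in> \<A> \<Longrightarrow> d_op G (\<A> \<inter> q) A = d_op G q A"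
  using l_coset_closed by (auto simp: d_op_def)

text \<open>Translates of members of \<open>\<A>\<close> stay in \<open>\<A>\<close>, so on
  \<open>\<A>\<close> the operator \<open>d_op\<close> does not distinguish \<open>r\<close> from
  its trace. The map of \<open>q\<close> is thus left multiplication by \<open>q\<close>, read
  modulo \<open>\<A>\<close>.\<close>

lemma ellis_map_apply: "uf r \<Longrightarrow> ellis_map G \<A> q (\<A> \<inter> r) = \<A> \<inter> ultra_mult G q r"
  using sets_into_space
  by (auto simp: ellis_map_def point_restrict ultra_mult_def d_op_restrict)

lemma ellis_map_closed: "uf q \<Longrightarrow> p \<in> topspace X \<Longrightarrow> ellis_map G \<A> q p \<in> topspace X"
  using point_extends ellis_map_apply point_restrict set_ultrafilter_ultra_mult by metis

lemma ellis_map_extensional: "uf q \<Longrightarrow> ellis_map G \<A> q \<in> topspace X \<rightarrow>\<^sub>E topspace X"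
  by (rule PiE_I, rule ellis_map_closed, assumption+) (simp add: ellis_map_def)

lemma compose_ellis_map:
  assumes "uf q" "uf r"
  shows "compose (topspace X) (ellis_map G \<A> q) (ellis_map G \<A> r) = ellis_map G \<A> (ultra_mult G q r)"
proof
  fix p show "compose (topspace X) (ellis_map G \<A> q) (ellis_map G \<A> r) p = ellis_map G \<A> (ultra_mult G q r) p"
  proof (cases "p \<in> topspace X")
    case True
    then obtain s where "uf s" "p = \<A> \<inter> s"
      using point_extends by blast
    then show ?thesis
      using True assms by (simp add: compose_def ellis_map_apply set_ultrafilter_ultra_mult ultra_mult_assoc)
  qed (simp add: compose_def ellis_map_def)
qed

lemma mem_stone_action_iff:
  assumes "p \<subseteq> \<A>" "g \<in> carrier G" "A \<subseteq> carrier G"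
  shows "A \<in> stone_action G g p \<longleftrightarrow> g \<in> d_op G p A"
proof
  assume "A \<in> stone_action G g p"
  then obtain B where "B \<in> p" "A = g <# B"
    by (auto simp: stone_action_def)
  then show "g \<in> d_op G p A"
    using assms sets_into_space[of B] by (auto simp: d_op_def lcos_m_assoc lcos_mult_one)
next
  assume "g \<in> d_op G p A"
  then have "A = g <# (inv g <# A)" "inv g <# A \<in> p"
    using assms by (auto simp: d_op_def lcos_m_assoc lcos_mult_one)
  then show "A \<in> stone_action G g p"
    unfolding stone_action_def by blast
qed

lemma stone_action_closed:
  assumes g: "g \<in> carrier G" and p: "p \<in> topspace X"
  shows "stone_action G g p \<in> topspace X"
proof -
  obtain q where q: "uf q" "p = \<A> \<inter> q"
    using point_extends p by blast
  have uf_principal: "uf {A. A \<subseteq> carrier G \<and> g \<in> A}"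
    using g by (auto simp: set_ultrafilter_def)
  \<comment> \<open>Translation by \<open>g\<close> is the map of the principal ultrafilter at
    \<open>g\<close>, so it inherits \<open>ellis_map_closed\<close>.\<close>
  have "stone_action G g p = ellis_map G \<A> {A. A \<subseteq> carrier G \<and> g \<in> A} p"
  proof (rule Set.set_eqI)
    fix A
    have "stone_action G g p \<subseteq> \<A>"
      using q g l_coset_closed by (auto simp: stone_action_def)
    then show "A \<in> stone_action G g p \<longleftrightarrow> A \<in> ellis_map G \<A> {A. A \<subseteq> carrier G \<and> g \<in> A} p"
      using mem_stone_action_iff[of p g A] g q p sets_into_space[of A] d_op_subset[of p A]
      by (auto simp: ellis_map_def)
  qed
  then show ?thesis
    using ellis_map_closed[OF uf_principal p] by simp
qed

text \<open>The closure consists of the limits of translations along ultrafilters. A point of the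
  closure yields sets of group elements with the finite intersection property; conversely, a basic
  neighbourhood imposes finitely many conditions, each fulfilled on a set of
  \<open>q\<close>.\<close>

lemma carrier_ellis_semigroup: "carrier E = ellis_map G \<A> ` {q. uf q}"
proof
  let ?P = "product_topology (\<lambda>_. X) (topspace X)"
  let ?O = "(\<lambda>g. restrict (stone_action G g) (topspace X)) ` carrier G"
  have car: "carrier E = ?P closure_of ?O"
    by (simp add: ellis_semigroup_def)
  show "carrier E \<subseteq> ellis_map G \<A> ` {q. uf q}"
  proof
    fix F assume F: "F \<in> carrier E"
    then have F_map: "F \<in> topspace X \<rightarrow>\<^sub>E topspace X"
      using closure_of_subset_topspace[of ?P] by (auto simp: car)
    \<comment> \<open>\<open>I\<close> collects the conditions \<open>A \<in> F p\<close>, and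
      \<open>B S\<close> is the set of group elements whose translation satisfies those in
      \<open>S\<close>. An ultrafilter containing all \<open>B S\<close> with \<open>S\<close>
      finite has \<open>F\<close> as its limit.\<close>
    define I where "I = {(p, A). p \<in> topspace X \<and> A \<in> F p}"
    define B where "B S = {g \<in> carrier G. \<forall>(p, A) \<in> S. g \<in> d_op G p A}" for S
    have FA: "F p \<subseteq> \<A>" if "p \<in> topspace X" for p
      using F_map that topspace_stone_space[of "carrier G" \<A>] by (auto simp: set_ultrafilter_def PiE_iff)
    have B_nonempty: "B S \<noteq> {}" if S: "finite S" "S \<subseteq> I" for S
    proof -
      define W where "W i = {f \<in> topspace ?P. f (fst i) \<in> {p. set_ultrafilter (carrier G) \<A> p \<and> snd i \<in> p}}" for i
      have "openin ?P (W i)" if "i \<in> S" for i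
        unfolding W_def using that S(2) subsetD[OF FA, of "fst i" "snd i"]
        by (intro openin_continuous_map_preimage[OF continuous_map_product_projection] openin_stone_space_basic)
          (auto simp: I_def)
      \<comment> \<open>The factor \<open>topspace ?P\<close> makes the intersection the whole
        product when \<open>S\<close> is empty.\<close>
      then have "openin ?P (topspace ?P \<inter> \<Inter>(W ` S))"
        using S(1)
        by (cases "S = {}") (auto intro!: openin_Int openin_Inter simp del: topspace_product_topology)
      moreover have "F (fst i) \<in> topspace X" "snd i \<in> F (fst i)" if "i \<in> S" for i
        using subsetD[OF S(2) that] PiE_mem[OF F_map, of "fst i"] by (simp_all add: I_def case_prod_beta)
      then have "F \<in> topspace ?P \<inter> \<Inter>(W ` S)"
        using F_map by (auto simp: W_def topspace_stone_space)
      ultimately obtain g where g: "g \<in> carrier G" "restrict (stone_action G g) (topspace X) \<in> topspace ?P \<inter> \<Inter>(W ` S)"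
        using F unfolding car in_closure_of by blast
      have "g \<in> d_op G p A" if "(p, A) \<in> S" for p A
      proof -
        have p: "p \<in> topspace X" "A \<in> \<A>"
          using that S FA by (auto simp: I_def)
        then have "A \<in> stone_action G g p"
          using that g by (auto simp: W_def)
        moreover have "p \<subseteq> \<A>"
          using p by (auto simp: topspace_stone_space set_ultrafilter_def)
        ultimately show ?thesis
          using mem_stone_action_iff g(1) sets_into_space[OF p(2)] by blast
      qed
      then show ?thesis
        using g(1) by (auto simp: B_def)
    qed
    obtain q where q: "uf q" "B ` {S. finite S \<and> S \<subseteq> I} \<subseteq> q"
    proof (rule ultrafilter_extends)
      show "B ` {S. finite S \<and> S \<subseteq> I} \<subseteq> Pow (carrier G)"
        by (auto simp: B_def)
      show "B ` {S. finite S \<and> S \<subseteq> I} \<noteq> {}"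
        by blast
      show "{} \<notin> B ` {S. finite S \<and> S \<subseteq> I}"
        using B_nonempty by auto
      show "A \<inter> A' \<in> B ` {S. finite S \<and> S \<subseteq> I}"
        if A: "A \<in> B ` {S. finite S \<and> S \<subseteq> I}" "A' \<in> B ` {S. finite S \<and> S \<subseteq> I}" for A A'
      proof -
        obtain S S' where S: "finite S" "S \<subseteq> I" "finite S'" "S' \<subseteq> I" "A = B S" "A' = B S'"
          using A by blast
        then have "A \<inter> A' = B (S \<union> S')"
          by (auto simp: B_def)
        then show ?thesis
          using S by simp
      qed
    qed
    \<comment> \<open>Both sides are ultrafilters of \<open>\<A>\<close>, so this inclusion is an
      equality by \<open>ultrafilter_maximal\<close>.\<close>
    have sub: "F p \<subseteq> ellis_map G \<A> q p" if p: "p \<in> topspace X" for p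
    proof
      fix A assume A: "A \<in> F p"
      then have "B {(p, A)} \<in> q"
        using q(2) p by (auto simp: I_def)
      moreover have "B {(p, A)} = d_op G p A"
        using subsetD[OF d_op_subset] by (auto simp: B_def)
      ultimately show "A \<in> ellis_map G \<A> q p"
        using A p FA by (auto simp: ellis_map_def)
    qed
    have "F = ellis_map G \<A> q"
    proof (rule PiE_ext[OF F_map ellis_map_extensional[OF q(1)]])
      show "F p = ellis_map G \<A> q p" if "p \<in> topspace X" for p
        using ultrafilter_maximal[OF _ _ sub[OF that]] PiE_mem[OF F_map that] ellis_map_closed[OF q(1) that]
        by (simp add: topspace_stone_space)
    qed
    then show "F \<in> ellis_map G \<A> ` {q. uf q}"
      using q by blast
  qed
  show "ellis_map G \<A> ` {q. uf q} \<subseteq> carrier E"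
  proof clarify
    fix q assume q: "uf q"
    show "ellis_map G \<A> q \<in> carrier E"
      unfolding car in_closure_of
    proof (intro conjI allI impI)
      show "ellis_map G \<A> q \<in> topspace ?P"
        using ellis_map_extensional[OF q] by simp
      fix W assume W: "ellis_map G \<A> q \<in> W \<and> openin ?P W"
      then obtain U where U: "finite {p \<in> topspace X. U p \<noteq> topspace X}"
        "\<And>p. p \<in> topspace X \<Longrightarrow> openin X (U p)"
        "ellis_map G \<A> q \<in> Pi\<^sub>E (topspace X) U" "Pi\<^sub>E (topspace X) U \<subseteq> W"
        by (auto simp: openin_product_topology_alt)
      define J where "J = {p \<in> topspace X. U p \<noteq> topspace X}"
      have "\<exists>A\<in>ellis_map G \<A> q p. {p'. set_ultrafilter (carrier G) \<A> p' \<and> A \<in> p'} \<subseteq> U p"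
        if "p \<in> topspace X" for p
        using stone_space_basic_nbhd[OF U(2)[OF that]] U(3) that by (auto simp: PiE_iff)
      then obtain a where a: "\<And>p. p \<in> topspace X \<Longrightarrow> a p \<in> ellis_map G \<A> q p"
        "\<And>p. p \<in> topspace X \<Longrightarrow> {p'. set_ultrafilter (carrier G) \<A> p' \<and> a p \<in> p'} \<subseteq> U p"
        by metis
      have d: "d_op G p (a p) \<in> q" "a p \<in> \<A>" if "p \<in> topspace X" for p
        using a(1)[OF that] that by (auto simp: ellis_map_def)
      have "finite J" "J \<subseteq> topspace X"
        using U(1) by (auto simp: J_def)
      \<comment> \<open>Only the finitely many coordinates in \<open>J\<close> constrain the
        translation. Any \<open>g\<close> in this set of \<open>q\<close> gives a translation inside
        \<open>W\<close>.\<close>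
      then have "carrier G \<inter> (\<Inter>p\<in>J. d_op G p (a p)) \<in> q"
      proof (induction rule: finite_induct)
        case empty
        then show ?case using q by (simp add: set_ultrafilter_def)
      next
        case (insert p J)
        then have "d_op G p (a p) \<inter> (carrier G \<inter> (\<Inter>p\<in>J. d_op G p (a p))) \<in> q"
          using q d(1)[of p] by (simp add: set_ultrafilter_def)
        then show ?case
          by (simp add: Int_left_commute)
      qed
      then have "carrier G \<inter> (\<Inter>p\<in>J. d_op G p (a p)) \<noteq> {}"
        using set_ultrafilterD(3)[OF q] by metis
      then obtain g where g: "g \<in> carrier G" "\<And>p. p \<in> J \<Longrightarrow> g \<in> d_op G p (a p)"
        by auto
      have "stone_action G g p \<in> U p" if p: "p \<in> topspace X" for p
      proof (cases "p \<in> J")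
        case True
        then have "a p \<in> stone_action G g p"
          using mem_stone_action_iff[of p g "a p"] g p d(2)[OF p] sets_into_space[of "a p"]
          by (auto simp: topspace_stone_space set_ultrafilter_def)
        moreover have "set_ultrafilter (carrier G) \<A> (stone_action G g p)"
          using stone_action_closed[OF g(1) p] by (simp add: topspace_stone_space)
        ultimately show ?thesis
          using a(2)[OF p] by blast
      next
        case False
        then show ?thesis
          using p stone_action_closed[OF g(1) p] by (simp add: J_def)
      qed
      then have "restrict (stone_action G g) (topspace X) \<in> W"
        using U(4) by (auto simp: subset_iff)
      then show "\<exists>y. y \<in> ?O \<and> y \<in> W"
        using g(1) by blast
    qed
  qed
qed

lemma mult_ellis_semigroup: "mult E = compose (topspace X)"
  by (simp add: ellis_semigroup_def)

end

section \<open>The strong Baire property relative to a dense subset\<close>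

text \<open>\<open>U\<close> and \<open>V\<close> play the roles of the interiors of
  \<open>A\<close> and of its complement relative to \<open>S\<close>. They are open in the ambient
  space, so that they can be translated by elements outside \<open>S\<close>, and they need not be
  the largest such sets.\<close>

definition sbp_witness :: "'a topology \<Rightarrow> 'a set \<Rightarrow> 'a set \<Rightarrow> 'a set \<Rightarrow> 'a set \<Rightarrow> bool" where
  "sbp_witness T S A U V \<longleftrightarrow> openin T U \<and> openin T V \<and> T closure_of (U \<union> V) = topspace T \<and>
     A \<subseteq> S \<and> U \<inter> S \<subseteq> A \<and> V \<inter> A = {}"

lemma openin_rho: "openin T (rho T A)"
  by (simp add: rho_def)

lemma rho_subset: "rho T A \<subseteq> topspace T"
  by (simp add: rho_def interior_of_subset_topspace)

text \<open>\<open>rho T A\<close> is regular open: it is the interior of a closed set, and that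
  closed set contains the closure of \<open>rho T A\<close>.\<close>

lemma rho_regular:
  assumes "openin T W" "W \<subseteq> T closure_of (rho T A)"
  shows "W \<subseteq> rho T A"
proof -
  have "T closure_of (rho T A) \<subseteq> T closure_of A"
    by (rule closure_of_minimal) (simp_all add: rho_def interior_of_subset)
  then show ?thesis
    using assms unfolding rho_def by (meson interior_of_maximal subset_trans)
qed

lemma rho_homeomorphic:
  assumes "homeomorphic_map T T f" "A \<subseteq> topspace T"
  shows "rho T (f ` A) = f ` rho T A"
  unfolding rho_def
  by (simp add: homeomorphic_map_closure_of[OF assms] homeomorphic_map_interior_of[OF assms(1) closure_of_subset_topspace])

lemma dense_homeomorphic:
  assumes f: "homeomorphic_map T T f" and "A \<subseteq> topspace T" "T closure_of A = topspace T"
  shows "T closure_of (f ` A) = topspace T"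
  using assms by (simp add: homeomorphic_map_closure_of homeomorphic_imp_surjective_map)

lemma dense_Int_openin:
  assumes "T closure_of U = topspace T" "openin T V" "T closure_of V = topspace T"
  shows "T closure_of (U \<inter> V) = topspace T"
  unfolding dense_intersects_open
proof (intro allI impI)
  fix W assume "openin T W \<and> W \<noteq> {}"
  then have "openin T (V \<inter> W) \<and> V \<inter> W \<noteq> {}"
    using assms(2,3) unfolding dense_intersects_open by blast
  then have "U \<inter> (V \<inter> W) \<noteq> {}"
    using assms(1) unfolding dense_intersects_open by blast
  then show "U \<inter> V \<inter> W \<noteq> {}"
    by (simp add: Int_assoc)
qed

lemma dense_mono:
  assumes "T closure_of A = topspace T" "A \<subseteq> B"
  shows "T closure_of B = topspace T"
  using assms closure_of_mono closure_of_subset_topspace by (metis subset_antisym)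

lemma sbp_witness_compl: "sbp_witness T S A U V \<Longrightarrow> sbp_witness T S (S - A) V U"
  by (auto simp: sbp_witness_def Un_commute)

lemma sbp_witness_meets:
  assumes "sbp_witness T S A U V" "openin T W" "(U \<union> V) \<inter> W = {}"
  shows "W = {}"
proof -
  have "T closure_of (U \<union> V) = topspace T"
    using assms(1) by (simp add: sbp_witness_def)
  then show ?thesis
    using assms(2,3) unfolding dense_intersects_open by metis
qed

lemma sbp_witness_Int:
  assumes "sbp_witness T S A U V" "sbp_witness T S A' U' V'"
  shows "sbp_witness T S (A \<inter> A') (U \<inter> U') (V \<union> V')"
proof -
  have "T closure_of ((U \<union> V) \<inter> (U' \<union> V')) = topspace T"
    using assms by (intro dense_Int_openin) (auto simp: sbp_witness_def)
  then have "T closure_of (U \<inter> U' \<union> (V \<union> V')) = topspace T"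
    by (rule dense_mono) blast
  then show ?thesis
    using assms by (auto simp: sbp_witness_def)
qed

lemma sbp_witness_SBP:
  assumes "sbp_witness T (topspace T) D U V"
  shows "D \<in> SBP T"
proof -
  have w: "openin T U" "openin T V" "T closure_of (U \<union> V) = topspace T" "D \<subseteq> topspace T"
    "U \<inter> topspace T \<subseteq> D" "V \<inter> D = {}"
    using assms by (simp_all add: sbp_witness_def)
  have "U \<subseteq> T interior_of D"
    using w(5) openin_subset[OF w(1)] by (intro interior_of_maximal w(1)) blast
  moreover have "V \<subseteq> T interior_of (topspace T - D)"
    using w(6) openin_subset[OF w(2)] by (intro interior_of_maximal w(2)) blast
  ultimately have "U \<union> V \<subseteq> T interior_of D \<union> T interior_of (topspace T - D)"
    by (rule Un_mono)
  then have "T closure_of (T interior_of D \<union> T interior_of (topspace T - D)) = topspace T"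
    by (rule dense_mono[OF w(3)])
  then show ?thesis
    using w(4) by (simp add: SBP_def)
qed

locale dense_subset =
  fixes T :: "'a topology" and S :: "'a set"
  assumes dense: "T closure_of S = topspace T" and subset_topspace: "S \<subseteq> topspace T"
begin

lemma meets: "openin T U \<Longrightarrow> U \<inter> S = {} \<Longrightarrow> U = {}"
  using dense unfolding dense_intersects_open by (metis Int_commute)

text \<open>The two interiors in the subspace are traces of open sets of \<open>T\<close>. The union
  of these is dense in \<open>T\<close> because its closure contains the dense set
  \<open>S\<close>.\<close>

lemma SBP_witness:
  assumes "A \<in> SBP (subtopology T S)"
  obtains U V where "sbp_witness T S A U V"
proof -
  have top: "topspace (subtopology T S) = S"
    using subset_topspace by auto
  obtain U where U: "openin T U" "(subtopology T S) interior_of A = U \<inter> S"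
    by (metis openin_interior_of openin_subtopology)
  obtain V where V: "openin T V" "(subtopology T S) interior_of (S - A) = V \<inter> S"
    by (metis openin_interior_of openin_subtopology)
  have A: "A \<subseteq> S" "(subtopology T S) closure_of (U \<inter> S \<union> V \<inter> S) = S"
    using assms unfolding SBP_def top mem_Collect_eq U(2) V(2) by simp_all
  have "S \<subseteq> T closure_of (U \<union> V)"
  proof -
    have "S = S \<inter> T closure_of (S \<inter> (U \<inter> S \<union> V \<inter> S))"
      using A(2) by (simp only: closure_of_subtopology)
    also have "\<dots> \<subseteq> T closure_of (U \<union> V)"
      by (rule le_infI2, rule closure_of_mono) blast
    finally show ?thesis .
  qed
  then have "T closure_of (U \<union> V) = topspace T"
    using closure_of_minimal[of S "T closure_of (U \<union> V)" T] dense closure_of_subset_topspace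
    by (metis closedin_closure_of subset_antisym)
  moreover have "U \<inter> S \<subseteq> A" "V \<inter> S \<subseteq> S - A"
    using U(2) V(2) interior_of_subset by metis+
  ultimately have "sbp_witness T S A U V"
    using U(1) V(1) A(1) by (auto simp: sbp_witness_def)
  then show ?thesis
    using that by blast
qed

lemma sbp_witness_disjoint:
  assumes "sbp_witness T S A U V"
  shows "U \<inter> V = {}"
proof (rule meets)
  show "openin T (U \<inter> V)"
    using assms by (simp add: sbp_witness_def openin_Int)
  show "U \<inter> V \<inter> S = {}"
    using assms unfolding sbp_witness_def by blast
qed

text \<open>An open set inside the complement of \<open>V\<close> has all its nonempty open parts
  meeting \<open>U\<close>, hence \<open>U \<inter> S\<close> by density of \<open>S\<close>, hence
  \<open>A\<close>. The right side mentions neither \<open>S\<close> nor \<open>A\<close>, so sets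
  with a common \<open>V\<close> have the same \<open>rho\<close>, even relative to different dense
  subsets.\<close>

lemma rho_eq:
  assumes "sbp_witness T S A U V"
  shows "rho T A = T interior_of (topspace T - V)"
proof (rule subset_antisym)
  have UV: "openin T U" "openin T V" "U \<inter> S \<subseteq> A" "V \<inter> A = {}" "A \<subseteq> topspace T"
    using assms subset_topspace by (auto simp: sbp_witness_def)
  have "T closure_of A \<subseteq> topspace T - V"
    using UV by (intro closure_of_minimal) auto
  then show "rho T A \<subseteq> T interior_of (topspace T - V)"
    unfolding rho_def by (rule interior_of_mono)
  show "T interior_of (topspace T - V) \<subseteq> rho T A"
    unfolding rho_def
  proof (rule interior_of_maximal)
    show "T interior_of (topspace T - V) \<subseteq> T closure_of A"
    proof
      fix x assume x: "x \<in> T interior_of (topspace T - V)"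
      show "x \<in> T closure_of A"
        unfolding in_closure_of
      proof (intro conjI allI impI)
        show "x \<in> topspace T"
          using x interior_of_subset_topspace by fast
        fix W assume W: "x \<in> W \<and> openin T W"
        let ?W = "W \<inter> T interior_of (topspace T - V)"
        have "openin T ?W" "?W \<noteq> {}"
          using W x by auto
        then have "(U \<union> V) \<inter> ?W \<noteq> {}"
          using sbp_witness_meets[OF assms] by blast
        moreover have "V \<inter> ?W = {}"
          using interior_of_subset[of T "topspace T - V"] by blast
        ultimately have "U \<inter> ?W \<noteq> {}"
          by blast
        then have "(U \<inter> ?W) \<inter> S \<noteq> {}"
          using meets[of "U \<inter> ?W"] UV(1) \<open>openin T ?W\<close> by blast
        then show "\<exists>y. y \<in> A \<and> y \<in> W"
          using UV(3) by blast
      qed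
    qed
  qed simp
qed

lemma sbp_witness_subset_rho:
  assumes "sbp_witness T S A U V"
  shows "U \<subseteq> rho T A" "V \<inter> rho T A = {}"
proof -
  have "openin T U" "U \<subseteq> topspace T - V"
    using assms sbp_witness_disjoint[OF assms] openin_subset[of T U] by (auto simp: sbp_witness_def)
  then show "U \<subseteq> rho T A"
    by (simp add: rho_eq[OF assms] interior_of_maximal)
  show "V \<inter> rho T A = {}"
    using interior_of_subset[of T "topspace T - V"] by (auto simp: rho_eq[OF assms])
qed

text \<open>The two values of \<open>rho\<close> miss \<open>U\<close> and \<open>V\<close>
  respectively, so their intersection is open and avoids a dense set. With \<open>rho_Int\<close>,
  this carries invariance of \<open>rho\<close> under translations over to Boolean
  combinations.\<close>

lemma rho_compl:
  assumes w: "sbp_witness T S A U V"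
  shows "rho T (S - A) = T interior_of (topspace T - rho T A)"
proof (rule subset_antisym)
  have c: "rho T (S - A) = T interior_of (topspace T - U)"
    using rho_eq[OF sbp_witness_compl[OF w]] .
  show "T interior_of (topspace T - rho T A) \<subseteq> rho T (S - A)"
    unfolding c using sbp_witness_subset_rho(1)[OF w] by (intro interior_of_mono) blast
  have "openin T (rho T (S - A) \<inter> rho T A)"
    by (simp add: openin_rho openin_Int)
  moreover have "(U \<union> V) \<inter> (rho T (S - A) \<inter> rho T A) = {}"
    using sbp_witness_subset_rho(2)[OF w] sbp_witness_subset_rho(2)[OF sbp_witness_compl[OF w]] by blast
  ultimately have "rho T (S - A) \<inter> rho T A = {}"
    by (rule sbp_witness_meets[OF w])
  then show "rho T (S - A) \<subseteq> T interior_of (topspace T - rho T A)"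
    using rho_subset[of T "S - A"] by (intro interior_of_maximal openin_rho) blast
qed

lemma rho_Int:
  assumes w: "sbp_witness T S A U V" and w': "sbp_witness T S A' U' V'"
  shows "rho T (A \<inter> A') = rho T A \<inter> rho T A'"
proof -
  have "topspace T - (V \<union> V') = (topspace T - V) \<inter> (topspace T - V')"
    by blast
  then show ?thesis
    by (simp add: rho_eq[OF w] rho_eq[OF w'] rho_eq[OF sbp_witness_Int[OF w w']] interior_of_Int)
qed

text \<open>Adding the part of \<open>U\<close> outside \<open>S\<close> turns \<open>A\<close> into
  the trace of a set with the strong Baire property in the ambient space. The witness is kept, and
  with it the value of \<open>rho\<close>.\<close>

lemma sbp_witness_extend:
  assumes w: "sbp_witness T S A U V"
  obtains D where "sbp_witness T (topspace T) D U V" "D \<inter> S = A"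
proof
  show "sbp_witness T (topspace T) (A \<union> (U - S)) U V"
    using w sbp_witness_disjoint[OF w] openin_subset[of T U] subset_topspace
    unfolding sbp_witness_def by blast
  show "(A \<union> (U - S)) \<inter> S = A"
    using w by (auto simp: sbp_witness_def)
qed

text \<open>Both sides are governed by \<open>U\<close> and \<open>V\<close>, whose union belongs to \<open>q\<close>.\<close>

lemma mem_ultrafilter_rho_iff:
  assumes w: "sbp_witness T S A U V"
    and q: "set_ultrafilter S (Pow S) q"
    and gen: "\<And>W. openin T W \<Longrightarrow> T closure_of W = topspace T \<Longrightarrow> W \<inter> S \<in> q"
  shows "A \<in> q \<longleftrightarrow> rho T A \<inter> S \<in> q"
proof -
  have AS: "A \<subseteq> S" "U \<inter> S \<subseteq> A" "V \<inter> A = {}"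
    using w by (auto simp: sbp_witness_def)
  have UV: "(U \<union> V) \<inter> S \<in> q"
    using w by (intro gen) (auto simp: sbp_witness_def)
  show ?thesis
  proof (cases "U \<inter> S \<in> q")
    case True
    moreover have "U \<inter> S \<subseteq> rho T A \<inter> S"
      using sbp_witness_subset_rho(1)[OF w] by blast
    ultimately show ?thesis
      using ultrafilter_mono[OF q] AS by (meson inf_le2)
  next
    case False
    then have "S - U \<inter> S \<in> q"
      using ultrafilter_compl_iff[OF q, of "U \<inter> S"] by simp
    from set_ultrafilterD(4)[OF q this UV] have V: "V \<inter> S \<in> q"
      by (rule ultrafilter_mono[OF q]) auto
    have "A \<notin> q" "rho T A \<inter> S \<notin> q"
      using ultrafilter_disjoint[OF q V] AS sbp_witness_subset_rho(2)[OF w] by blast+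
    then show ?thesis
      by simp
  qed
qed

end

section \<open>Translations in a topological group\<close>

lemma (in group) mem_r_coset_iff:
  assumes "g \<in> carrier G" "x \<in> carrier G" "A \<subseteq> carrier G"
  shows "x \<in> A #> g \<longleftrightarrow> x \<otimes> inv g \<in> A"
proof
  assume "x \<in> A #> g"
  then obtain a where "a \<in> A" "x = a \<otimes> g"
    by (auto simp: r_coset_def)
  then show "x \<otimes> inv g \<in> A"
    using assms by (simp add: subset_iff m_assoc)
next
  assume "x \<otimes> inv g \<in> A"
  moreover have "x = (x \<otimes> inv g) \<otimes> g"
    using assms by (simp add: m_assoc)
  ultimately show "x \<in> A #> g"
    unfolding r_coset_def by blast
qed

lemma (in group) l_coset_r_coset:
  assumes "g \<in> carrier G" "h \<in> carrier G" "A \<subseteq> carrier G"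
  shows "(g <# A) #> h = g <# (A #> h)"
  using assms by (auto simp: l_coset_def r_coset_def subset_iff m_assoc)

lemma (in group) r_coset_Int:
  assumes "g \<in> carrier G" "A \<subseteq> carrier G" "B \<subseteq> carrier G"
  shows "(A \<inter> B) #> g = (A #> g) \<inter> (B #> g)"
proof (rule subset_eqI)
  have AB: "A \<inter> B \<subseteq> carrier G"
    using assms by blast
  then show "(A \<inter> B) #> g \<subseteq> carrier G"
    using assms r_coset_subset_G by blast
  show "(A #> g) \<inter> (B #> g) \<subseteq> carrier G"
    using assms r_coset_subset_G by blast
  show "x \<in> (A \<inter> B) #> g \<longleftrightarrow> x \<in> (A #> g) \<inter> (B #> g)" if "x \<in> carrier G" for x
    using mem_r_coset_iff[OF assms(1) that AB] mem_r_coset_iff[OF assms(1) that] assms by simp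
qed

lemma (in group) r_coset_Diff:
  assumes "g \<in> carrier G" "A \<subseteq> carrier G"
  shows "(carrier G - A) #> g = carrier G - (A #> g)"
proof (rule subset_eqI)
  show "(carrier G - A) #> g \<subseteq> carrier G"
    using assms r_coset_subset_G by blast
  show "x \<in> (carrier G - A) #> g \<longleftrightarrow> x \<in> carrier G - (A #> g)" if "x \<in> carrier G" for x
    using assms that by (simp add: mem_r_coset_iff)
qed simp

lemma l_coset_image: "g <#\<^bsub>G\<^esub> A = (\<lambda>x. g \<otimes>\<^bsub>G\<^esub> x) ` A"
  by (auto simp: l_coset_def)

lemma r_coset_image: "A #>\<^bsub>G\<^esub> g = (\<lambda>x. x \<otimes>\<^bsub>G\<^esub> g) ` A"
  by (auto simp: r_coset_def)

context topological_group
begin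

lemma continuous_map_left: "g \<in> carrier G \<Longrightarrow> continuous_map T T (\<lambda>x. g \<otimes> x)"
  using continuous_map_compose[OF _ continuous_mult, of T "\<lambda>x. (g, x)"]
  by (simp add: continuous_map_pairedI topspace_eq o_def)

lemma continuous_map_right: "g \<in> carrier G \<Longrightarrow> continuous_map T T (\<lambda>x. x \<otimes> g)"
  using continuous_map_compose[OF _ continuous_mult, of T "\<lambda>x. (x, g)"]
  by (simp add: continuous_map_pairedI topspace_eq o_def)

lemma homeomorphic_map_left:
  assumes "g \<in> carrier G"
  shows "homeomorphic_map T T (\<lambda>x. g \<otimes> x)"
proof -
  have "homeomorphic_maps T T (\<lambda>x. g \<otimes> x) (\<lambda>x. inv g \<otimes> x)"
    using assms by (simp add: homeomorphic_maps_def continuous_map_left topspace_eq m_assoc[symmetric])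
  then show ?thesis
    using homeomorphic_map_maps by blast
qed

lemma homeomorphic_map_right:
  assumes "g \<in> carrier G"
  shows "homeomorphic_map T T (\<lambda>x. x \<otimes> g)"
proof -
  have "homeomorphic_maps T T (\<lambda>x. x \<otimes> g) (\<lambda>x. x \<otimes> inv g)"
    using assms by (simp add: homeomorphic_maps_def continuous_map_right topspace_eq m_assoc)
  then show ?thesis
    using homeomorphic_map_maps by blast
qed

lemma openin_l_coset: "g \<in> carrier G \<Longrightarrow> openin T U \<Longrightarrow> openin T (g <# U)"
  using homeomorphic_map_openness[OF homeomorphic_map_left openin_subset]
  by (simp add: l_coset_image)

lemma openin_r_coset: "g \<in> carrier G \<Longrightarrow> openin T U \<Longrightarrow> openin T (U #> g)"
  using homeomorphic_map_openness[OF homeomorphic_map_right openin_subset]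
  by (simp add: r_coset_image)

lemma rho_l_coset: "g \<in> carrier G \<Longrightarrow> A \<subseteq> carrier G \<Longrightarrow> rho T (g <# A) = g <# rho T A"
  by (simp add: l_coset_image rho_homeomorphic homeomorphic_map_left topspace_eq)

lemma rho_r_coset: "g \<in> carrier G \<Longrightarrow> A \<subseteq> carrier G \<Longrightarrow> rho T (A #> g) = rho T A #> g"
  by (simp add: r_coset_image rho_homeomorphic homeomorphic_map_right topspace_eq)

lemma rho_carrier: "rho T A \<subseteq> carrier G"
  using rho_subset[of T A] by (simp add: topspace_eq)

lemma interior_of_r_coset:
  "g \<in> carrier G \<Longrightarrow> A \<subseteq> carrier G \<Longrightarrow> T interior_of (A #> g) = (T interior_of A) #> g"
  by (simp add: r_coset_image homeomorphic_map_interior_of homeomorphic_map_right topspace_eq)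

lemma sbp_witness_l_coset:
  assumes "g \<in> carrier G" "sbp_witness T S A U V" "S \<subseteq> carrier G" "g <# S = S"
  shows "sbp_witness T S (g <# A) (g <# U) (g <# V)"
proof -
  have UV: "openin T U" "openin T V" "U \<subseteq> carrier G" "V \<subseteq> carrier G" "A \<subseteq> S" "U \<inter> S \<subseteq> A" "V \<inter> A = {}"
    using assms(2) openin_subset[of T U] openin_subset[of T V] by (auto simp: sbp_witness_def topspace_eq)
  have A: "A \<subseteq> carrier G"
    using UV assms by blast
  have "T closure_of (g <# (U \<union> V)) = topspace T"
    unfolding l_coset_image using assms(2) UV
    by (intro dense_homeomorphic homeomorphic_map_left assms(1)) (auto simp: sbp_witness_def topspace_eq)
  moreover have "g <# (U \<union> V) = (g <# U) \<union> (g <# V)"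
    by (auto simp: l_coset_image)
  moreover have "(g <# U) \<inter> S \<subseteq> g <# A"
    using l_coset_Int[OF assms(1) UV(3) assms(3)] l_coset_mono[OF UV(6), of g] assms(4) by simp
  moreover have "(g <# V) \<inter> (g <# A) = {}"
    using l_coset_Int[OF assms(1) UV(4) A] UV(7) by (simp add: l_coset_image)
  moreover have "g <# A \<subseteq> S"
    using l_coset_mono[OF UV(5), of g] assms(4) by simp
  ultimately show ?thesis
    using openin_l_coset[OF assms(1)] UV by (simp add: sbp_witness_def)
qed

lemma sbp_witness_r_coset:
  assumes g: "g \<in> carrier G" and w: "sbp_witness T (carrier G) A U V"
  shows "sbp_witness T (carrier G) (A #> g) (U #> g) (V #> g)"
proof -
  have UV: "openin T U" "openin T V" "U \<subseteq> carrier G" "V \<subseteq> carrier G" "A \<subseteq> carrier G" "U \<subseteq> A" "V \<inter> A = {}"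
    using w openin_subset[of T U] openin_subset[of T V] by (auto simp: sbp_witness_def topspace_eq)
  have "T closure_of ((U \<union> V) #> g) = topspace T"
    unfolding r_coset_image using w UV
    by (intro dense_homeomorphic homeomorphic_map_right g) (auto simp: sbp_witness_def topspace_eq)
  moreover have "(U \<union> V) #> g = (U #> g) \<union> (V #> g)"
    by (auto simp: r_coset_image)
  moreover have "U #> g \<subseteq> A #> g"
    using UV(6) by (auto simp: r_coset_image)
  moreover have "(V #> g) \<inter> (A #> g) = {}"
    using r_coset_Int[OF g UV(4,5)] UV(7) by (simp add: r_coset_image)
  ultimately show ?thesis
    using openin_r_coset[OF g] UV r_coset_subset_G[OF UV(5) g] by (auto simp: sbp_witness_def)
qed

end

section \<open>Ultrafilters on a dense subgroup of a compact group\<close>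

lemma l_coset_subgroup [simp]: "g <#\<^bsub>H\<lparr>carrier := G\<rparr>\<^esub> A = g <#\<^bsub>H\<^esub> A"
  by (simp add: l_coset_def)

locale compact_dense_subgroup = topological_group H T for H (structure) and T +
  fixes G :: "'a set"
  assumes compact: "compact_space T"
    and subgroup: "subgroup G H"
    and dense_G: "T closure_of G = topspace T"
begin

abbreviation "\<G> \<equiv> H\<lparr>carrier := G\<rparr>"

abbreviation "ultra q \<equiv> set_ultrafilter G (Pow G) q"

text \<open>A relation and not a function: without a separation axiom an ultrafilter may have
  several limits.\<close>

definition converges :: "'a set set \<Rightarrow> 'a \<Rightarrow> bool" where
  "converges q x \<longleftrightarrow> x \<in> carrier H \<and> (\<forall>U. openin T U \<longrightarrow> x \<in> U \<longrightarrow> U \<inter> G \<in> q)"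

text \<open>Equivalently, no nowhere dense subset of \<open>G\<close> is in \<open>q\<close>, since
  the complement of the closure of such a set is a dense open set.\<close>

definition generic :: "'a set set \<Rightarrow> bool" where
  "generic q \<longleftrightarrow> ultra q \<and> (\<forall>U. openin T U \<longrightarrow> T closure_of U = topspace T \<longrightarrow> U \<inter> G \<in> q)"

lemma G_subset: "G \<subseteq> carrier H"
  using subgroup by (rule subgroup.subset)

lemma inv_G: "g \<in> G \<Longrightarrow> inv g \<in> G"
  using subgroup by (rule subgroup.m_inv_closed)

lemma group_G: "group \<G>"
  using subgroup.subgroup_is_group[OF subgroup group_axioms] .

sublocale dense_subset T G
  using dense_G G_subset by unfold_locales (simp_all add: topspace_eq)

lemma d_op_eq: "d_op \<G> q A = {h \<in> G. inv h <# A \<in> q}"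
  using m_inv_consistent[OF subgroup] by (auto simp: d_op_def)

lemma ultra_ultra_mult: "ultra q \<Longrightarrow> ultra r \<Longrightarrow> ultra (ultra_mult \<G> q r)"
  using group.set_ultrafilter_ultra_mult[OF group_G] by simp

lemma ultra_mult_subgroup_iff: "A \<in> ultra_mult \<G> q r \<longleftrightarrow> A \<subseteq> G \<and> d_op \<G> r A \<in> q"
  by (simp add: ultra_mult_def)

lemma d_op_subset_G: "d_op \<G> q A \<subseteq> G"
  using group.d_op_subset[OF group_G] by simp

lemma d_op_Compl_G: "ultra q \<Longrightarrow> A \<subseteq> G \<Longrightarrow> d_op \<G> q (G - A) = G - d_op \<G> q A"
  using group.d_op_compl[OF group_G] by simp

lemma converges_carrier: "converges q x \<Longrightarrow> x \<in> carrier H"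
  by (simp add: converges_def)

lemma convergesD: "converges q x \<Longrightarrow> openin T U \<Longrightarrow> x \<in> U \<Longrightarrow> U \<inter> G \<in> q"
  by (simp add: converges_def)

lemma generic_ultra: "generic q \<Longrightarrow> ultra q"
  by (simp add: generic_def)

lemma genericD: "generic q \<Longrightarrow> openin T U \<Longrightarrow> T closure_of U = topspace T \<Longrightarrow> U \<inter> G \<in> q"
  by (simp add: generic_def)

text \<open>Otherwise, by compactness, finitely many open sets with traces outside \<open>q\<close>
  would cover \<open>G\<close>.\<close>

lemma ultra_converges:
  assumes q: "ultra q"
  obtains x where "converges q x"
proof -
  have "\<exists>x. converges q x"
  proof (rule ccontr)
    assume "\<nexists>x. converges q x"
    then have "\<forall>x\<in>carrier H. \<exists>U. openin T U \<and> x \<in> U \<and> U \<inter> G \<notin> q"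
      unfolding converges_def by metis
    then obtain U where U: "\<And>x. x \<in> carrier H \<Longrightarrow> openin T (U x) \<and> x \<in> U x \<and> U x \<inter> G \<notin> q"
      by metis
    then have "\<forall>V \<in> U ` carrier H. openin T V" "topspace T \<subseteq> \<Union>(U ` carrier H)"
      by (auto simp: topspace_eq)
    then obtain \<F> where \<F>: "finite \<F>" "\<F> \<subseteq> U ` carrier H" "topspace T \<subseteq> \<Union>\<F>"
      using compact unfolding compact_space_alt by metis
    have "G \<subseteq> \<Union>\<F>"
      using \<F>(3) subset_topspace by (rule subset_trans[rotated])
    then have "\<Union>((\<lambda>V. V \<inter> G) ` \<F>) = G"
      by auto
    then have "\<Union>((\<lambda>V. V \<inter> G) ` \<F>) \<in> q"
      using set_ultrafilterD(2)[OF q] by simp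
    from ultrafilter_finite_Union[OF q _ _ this] obtain V where "V \<in> \<F>" "V \<inter> G \<in> q"
      using \<F>(1) by auto
    then show False
      using \<F>(2) U by auto
  qed
  then show ?thesis
    using that by blast
qed

text \<open>Traces of dense open sets intersected with neighbourhoods of \<open>x\<close> form a
  filter base. They are nonempty because a dense open set meets each neighbourhood in a nonempty
  open set, which meets the dense set \<open>G\<close>.\<close>

lemma generic_converges:
  assumes x: "x \<in> carrier H"
  obtains q where "generic q" "converges q x"
proof -
  define \<S> where "\<S> = {U \<inter> V \<inter> G |U V. openin T U \<and> T closure_of U = topspace T \<and> openin T V \<and> x \<in> V}"
  have SI: "U \<inter> V \<inter> G \<in> \<S>" if "openin T U" "T closure_of U = topspace T" "openin T V" "x \<in> V" for U V
    unfolding \<S>_def by (rule CollectI, rule exI[of _ U], rule exI[of _ V], intro conjI refl that)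
  have top: "openin T (topspace T)" "T closure_of (topspace T) = topspace T" "x \<in> topspace T"
    by (simp_all only: openin_topspace closure_of_topspace) (simp add: topspace_eq x)
  obtain q where q: "ultra q" "\<S> \<subseteq> q"
  proof (rule ultrafilter_extends)
    show "\<S> \<subseteq> Pow G"
      by (auto simp: \<S>_def)
    show "\<S> \<noteq> {}"
      using SI[OF top(1,2,1,3)] by (meson ex_in_conv)
    show "{} \<notin> \<S>"
    proof
      assume "{} \<in> \<S>"
      then obtain U V where UV: "{} = U \<inter> V \<inter> G" "openin T U" "T closure_of U = topspace T" "openin T V" "x \<in> V"
        unfolding \<S>_def by blast
      then have "U \<inter> V = {}"
        using meets[of "U \<inter> V"] by (simp add: openin_Int)
      moreover have "U \<inter> V \<noteq> {}"
        using UV(3,4,5) unfolding dense_intersects_open by (metis ex_in_conv)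
      ultimately show False
        by simp
    qed
    show "A \<inter> B \<in> \<S>" if AB: "A \<in> \<S>" "B \<in> \<S>" for A B
    proof -
      obtain U V where UV: "A = U \<inter> V \<inter> G" "openin T U" "T closure_of U = topspace T" "openin T V" "x \<in> V"
        using AB(1) unfolding \<S>_def by blast
      obtain U' V' where UV': "B = U' \<inter> V' \<inter> G" "openin T U'" "T closure_of U' = topspace T" "openin T V'" "x \<in> V'"
        using AB(2) unfolding \<S>_def by blast
      have "A \<inter> B = (U \<inter> U') \<inter> (V \<inter> V') \<inter> G"
        unfolding UV UV' by blast
      also have "\<dots> \<in> \<S>"
        using UV UV' by (intro SI) (simp_all add: dense_Int_openin openin_Int)
      finally show ?thesis .
    qed
  qed
  have "U \<inter> G \<in> q" if "openin T U" "T closure_of U = topspace T" for U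
  proof -
    have "U \<inter> topspace T = U"
      using openin_subset[OF that(1)] by blast
    then show ?thesis
      using subsetD[OF q(2) SI[OF that top(1,3)]] by simp
  qed
  moreover have "V \<inter> G \<in> q" if "openin T V" "x \<in> V" for V
  proof -
    have "topspace T \<inter> V = V"
      using openin_subset[OF that(1)] by blast
    then show ?thesis
      using subsetD[OF q(2) SI[OF top(1,2) that]] by simp
  qed
  ultimately have "generic q" "converges q x"
    using q(1) x by (simp_all add: generic_def converges_def)
  then show ?thesis
    by (rule that)
qed

text \<open>If \<open>h \<otimes> y \<in> U\<close>, then \<open>inv h <# U\<close> is an open
  neighbourhood of the limit \<open>y\<close>, so its trace is in \<open>r\<close>. Since
  \<open>inv h <# G = G\<close>, this trace lies in \<open>inv h <# A\<close>.\<close>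

lemma d_op_openin:
  assumes r: "ultra r" "converges r y" and U: "openin T U" "U \<inter> G \<subseteq> A" "A \<subseteq> G"
  shows "(U #> inv y) \<inter> G \<subseteq> d_op \<G> r A"
proof
  fix h assume h: "h \<in> (U #> inv y) \<inter> G"
  have y: "y \<in> carrier H"
    using r(2) by (rule converges_carrier)
  have hG: "h \<in> G" "h \<in> carrier H" "inv h \<in> G" "inv h \<in> carrier H"
    using h G_subset inv_G by auto
  have Uc: "U \<subseteq> carrier H"
    using openin_subset[OF U(1)] by (simp add: topspace_eq)
  have "h \<otimes> y \<in> U"
    using h y hG Uc mem_r_coset_iff[of "inv y" h U] by simp
  then have "y \<in> inv h <# U"
    using mem_l_coset_iff[of "inv h" y U] hG y Uc by simp
  then have "(inv h <# U) \<inter> G \<in> r"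
    using convergesD[OF r(2)] openin_l_coset U(1) hG by simp
  moreover have "inv h <# G = G"
    using hG coset_join3[OF _ subgroup] by simp
  then have "(inv h <# U) \<inter> G = inv h <# (U \<inter> G)"
    using l_coset_Int[of "inv h" U G] hG Uc G_subset by simp
  then have "(inv h <# U) \<inter> G \<subseteq> inv h <# A"
    using l_coset_mono[OF U(2)] by simp
  moreover have "inv h <# A \<subseteq> G"
    using l_coset_mono[OF U(3), of "inv h"] \<open>inv h <# G = G\<close> by simp
  ultimately have "inv h <# A \<in> r"
    using ultrafilter_mono[OF r(1)] by simp
  then show "h \<in> d_op \<G> r A"
    using hG by (simp add: d_op_eq)
qed

text \<open>\<open>d_op_openin\<close> is applied to \<open>A\<close> with \<open>U\<close> and to
  the complement of \<open>A\<close> with \<open>V\<close>. The strong Baire property is preserved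
  by \<open>d_op\<close>, and \<open>rho_d_op\<close> can be read off from the translated
  \<open>V\<close>.\<close>

lemma sbp_witness_d_op:
  assumes r: "ultra r" "converges r y" and w: "sbp_witness T G A U V"
  shows "sbp_witness T G (d_op \<G> r A) (U #> inv y) (V #> inv y)"
proof -
  have y: "inv y \<in> carrier H"
    using converges_carrier[OF r(2)] by simp
  have UV: "openin T U" "openin T V" "A \<subseteq> G" "U \<inter> G \<subseteq> A" "V \<inter> A = {}" "T closure_of (U \<union> V) = topspace T"
    using w by (simp_all add: sbp_witness_def)
  have sub: "U \<union> V \<subseteq> topspace T"
    using UV(1,2) openin_subset by (metis Un_least)
  have "T closure_of ((U \<union> V) #> inv y) = topspace T"
    unfolding r_coset_image by (rule dense_homeomorphic[OF homeomorphic_map_right[OF y] sub UV(6)])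
  moreover have "(U \<union> V) #> inv y = (U #> inv y) \<union> (V #> inv y)"
    by (auto simp: r_coset_image)
  moreover have "(V #> inv y) \<inter> G \<subseteq> d_op \<G> r (G - A)"
    using UV(5) by (intro d_op_openin r UV(2)) blast+
  then have "(V #> inv y) \<inter> d_op \<G> r A = {}"
    using d_op_subset_G[of r A] by (auto simp: d_op_Compl_G[OF r(1) UV(3)])
  ultimately show ?thesis
    using d_op_openin[OF r UV(1,4,3)] openin_r_coset[OF y] UV(1,2) d_op_subset_G by (simp add: sbp_witness_def)
qed

lemma rho_d_op:
  assumes r: "ultra r" "converges r y" and w: "sbp_witness T G A U V"
  shows "rho T (d_op \<G> r A) = rho T A #> inv y"
proof -
  have y: "inv y \<in> carrier H"
    using converges_carrier[OF r(2)] by simp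
  have V: "V \<subseteq> carrier H"
    using w openin_subset[of T V] by (simp add: sbp_witness_def topspace_eq)
  show ?thesis
    unfolding rho_eq[OF w] rho_eq[OF sbp_witness_d_op[OF r w]]
    by (simp add: topspace_eq interior_of_r_coset[OF y, symmetric] r_coset_Diff[OF y V])
qed

text \<open>For a neighbourhood \<open>U\<close> of \<open>x \<otimes> y\<close>, the translate
  \<open>U #> inv y\<close> is a neighbourhood of \<open>x\<close>, and \<open>d_op_openin\<close>
  places its trace inside \<open>d_op \<G> r (U \<inter> G)\<close>.\<close>

lemma converges_ultra_mult:
  assumes q: "ultra q" "converges q x" and r: "ultra r" "converges r y"
  shows "converges (ultra_mult \<G> q r) (x \<otimes> y)"
  unfolding converges_def
proof (intro conjI allI impI)
  have xy: "x \<in> carrier H" "y \<in> carrier H"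
    using q(2) r(2) by (simp_all add: converges_carrier)
  then show "x \<otimes> y \<in> carrier H"
    by simp
  fix U assume U: "openin T U" "x \<otimes> y \<in> U"
  have "U \<subseteq> carrier H"
    using openin_subset[OF U(1)] by (simp add: topspace_eq)
  then have "x \<in> U #> inv y"
    using mem_r_coset_iff[of "inv y" x U] xy U(2) by simp
  then have "(U #> inv y) \<inter> G \<in> q"
    using convergesD[OF q(2)] openin_r_coset U(1) xy by simp
  then have "d_op \<G> r (U \<inter> G) \<in> q"
    using d_op_openin[OF r U(1) subset_refl] d_op_subset_G ultrafilter_mono[OF q(1)] by simp
  then show "U \<inter> G \<in> ultra_mult \<G> q r"
    by (simp add: ultra_mult_subgroup_iff)
qed

text \<open>Left translates of a dense open set are dense open, so
  \<open>d_op \<G> q (U \<inter> G)\<close> is all of \<open>G\<close>. This makes the generic maps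
  a left ideal.\<close>

lemma generic_ultra_mult:
  assumes r: "ultra r" and q: "generic q"
  shows "generic (ultra_mult \<G> r q)"
  unfolding generic_def
proof (intro conjI allI impI)
  show "ultra (ultra_mult \<G> r q)"
    using assms by (simp add: ultra_ultra_mult generic_ultra)
  fix U assume U: "openin T U" "T closure_of U = topspace T"
  have Uc: "U \<subseteq> carrier H"
    using openin_subset[OF U(1)] by (simp add: topspace_eq)
  have "h \<in> d_op \<G> q (U \<inter> G)" if "h \<in> G" for h
  proof -
    have h: "inv h \<in> carrier H" "inv h \<in> G"
      using that G_subset inv_G by auto
    have "T closure_of (inv h <# U) = topspace T"
      unfolding l_coset_image by (rule dense_homeomorphic[OF homeomorphic_map_left[OF h(1)] openin_subset[OF U(1)] U(2)])
    moreover have "openin T (inv h <# U)"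
      using openin_l_coset[OF h(1) U(1)] .
    ultimately have "(inv h <# U) \<inter> G \<in> q"
      using genericD[OF q] by simp
    moreover have "inv h <# G = G"
      using coset_join3[OF h(1) subgroup h(2)] .
    then have "(inv h <# U) \<inter> G = inv h <# (U \<inter> G)"
      using l_coset_Int[OF h(1) Uc G_subset] by simp
    ultimately show ?thesis
      using that by (simp add: d_op_eq)
  qed
  then have "d_op \<G> q (U \<inter> G) = G"
    using d_op_subset_G by (metis subsetI subset_antisym)
  then show "U \<inter> G \<in> ultra_mult \<G> r q"
    using set_ultrafilterD(2)[OF r] by (simp add: ultra_mult_subgroup_iff)
qed

lemma generic_mem_iff:
  assumes "generic q" "sbp_witness T G A U V"
  shows "A \<in> q \<longleftrightarrow> rho T A \<inter> G \<in> q"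
  using mem_ultrafilter_rho_iff[OF assms(2) generic_ultra[OF assms(1)]] genericD[OF assms(1)] by simp

lemma generic_mem_d_op_iff:
  assumes "generic q" "ultra r" "converges r y" "sbp_witness T G A U V"
  shows "d_op \<G> r A \<in> q \<longleftrightarrow> (rho T A #> inv y) \<inter> G \<in> q"
  using generic_mem_iff[OF assms(1) sbp_witness_d_op[OF assms(2-4)]] rho_d_op[OF assms(2-4)] by simp

end

section \<open>The Ellis group\<close>

locale sbp_algebra = compact_dense_subgroup H T G for H (structure) and T and G :: "'a set" +
  fixes \<A> :: "'a set set"
  assumes alg: "G_algebra \<G> \<A>"
    and sbp: "\<A> \<subseteq> SBP (subtopology T G)"
begin

sublocale sub: group_algebra \<G> \<A>
  using group_G alg by (simp add: group_algebra_def group_algebra_axioms_def)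

abbreviation "X \<equiv> stone_space G \<A>"

abbreviation "E \<equiv> ellis_semigroup \<G> X (stone_action \<G>)"

abbreviation "emap q \<equiv> ellis_map \<G> \<A> q"

abbreviation um :: "'a set set \<Rightarrow> 'a set set \<Rightarrow> 'a set set" (infixl \<open>\<star>\<close> 70)
  where "q \<star> r \<equiv> ultra_mult \<G> q r"

lemma carrier_E: "carrier E = emap ` {q. ultra q}"
  using sub.carrier_ellis_semigroup by simp

lemma emap_in_E: "ultra q \<Longrightarrow> emap q \<in> carrier E"
  unfolding carrier_E by blast

lemma mult_emap: "ultra q \<Longrightarrow> ultra r \<Longrightarrow> emap q \<otimes>\<^bsub>E\<^esub> emap r = emap (q \<star> r)"
  using sub.compose_ellis_map[of q r] sub.mult_ellis_semigroup by simp

lemma star_assoc: "q \<star> r \<star> s = q \<star> (r \<star> s)"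
  using sub.ultra_mult_assoc .

lemma witness:
  assumes "A \<in> \<A>"
  obtains U V where "sbp_witness T G A U V"
  using SBP_witness subsetD[OF sbp assms] by blast

lemma algebra_subset_G: "A \<in> \<A> \<Longrightarrow> A \<subseteq> G"
  using sub.sets_into_space by simp

lemma mem_emap_iff:
  assumes "ultra s" "A \<in> \<A>"
  shows "A \<in> emap q (\<A> \<inter> s) \<longleftrightarrow> d_op \<G> s A \<in> q"
  using sub.ellis_map_apply[of s q] assms algebra_subset_G by (simp add: ultra_mult_subgroup_iff)

text \<open>Every point of the Stone space is the trace of an ultrafilter \<open>s\<close>. The
  limit \<open>y\<close> of \<open>s\<close> is supplied because the membership criteria for generic
  ultrafilters are phrased by limits.\<close>

lemma emap_eqI:
  assumes "\<And>s y A. ultra s \<Longrightarrow> converges s y \<Longrightarrow> A \<in> \<A> \<Longrightarrow> d_op \<G> s A \<in> q \<longleftrightarrow> d_op \<G> s A \<in> r"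
  shows "emap q = emap r"
proof
  fix p
  show "emap q p = emap r p"
  proof (cases "p \<in> topspace X")
    case True
    then obtain s where s: "ultra s" "p = \<A> \<inter> s"
      using sub.point_extends[of p] by auto
    obtain y where y: "converges s y"
      using ultra_converges[OF s(1)] .
    have "emap t p \<subseteq> \<A>" for t
      using sub.ellis_map_apply[of s t] s by simp
    moreover have "A \<in> emap q p \<longleftrightarrow> A \<in> emap r p" if "A \<in> \<A>" for A
      using assms[OF s(1) y that] mem_emap_iff[OF s(1) that] s(2) by simp
    ultimately show ?thesis
      by (intro subset_eqI)
  next
    case False
    then show ?thesis
      by (simp add: ellis_map_def)
  qed
qed

lemma mem_emap_generic:
  assumes "generic q" "ultra s" "converges s y" "A \<in> \<A>"
  shows "d_op \<G> s A \<in> q \<longleftrightarrow> (rho T A #> inv y) \<inter> G \<in> q"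
  using witness[OF assms(4)] generic_mem_d_op_iff[OF assms(1-3)] by blast

text \<open>Applying \<open>rho_d_op\<close> for \<open>s\<close> and then for \<open>r\<close>
  leaves a translate of \<open>rho T A\<close> in which \<open>r\<close> and \<open>s\<close> occur
  only through their limits.\<close>

lemma mem_emap_generic_mult:
  assumes "generic q" "ultra r" "converges r x" "ultra s" "converges s y" "A \<in> \<A>"
  shows "d_op \<G> s A \<in> q \<star> r \<longleftrightarrow> (rho T A #> (inv y \<otimes> inv x)) \<inter> G \<in> q"
proof -
  obtain U V where w: "sbp_witness T G A U V"
    using witness[OF assms(6)] .
  have xy: "x \<in> carrier H" "y \<in> carrier H"
    using assms by (simp_all add: converges_carrier)
  have "d_op \<G> s A \<in> q \<star> r \<longleftrightarrow> d_op \<G> r (d_op \<G> s A) \<in> q"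
    by (simp add: ultra_mult_subgroup_iff d_op_subset_G)
  also have "\<dots> \<longleftrightarrow> (rho T (d_op \<G> s A) #> inv x) \<inter> G \<in> q"
    by (rule generic_mem_d_op_iff[OF assms(1-3) sbp_witness_d_op[OF assms(4,5) w]])
  also have "rho T (d_op \<G> s A) = rho T A #> inv y"
    by (rule rho_d_op[OF assms(4,5) w])
  also have "rho T A #> inv y #> inv x = rho T A #> (inv y \<otimes> inv x)"
    using xy by (simp add: coset_mult_assoc rho_carrier)
  finally show ?thesis .
qed

lemma emap_generic_mult_cong:
  assumes "generic q" "ultra r" "converges r x" "ultra r'" "converges r' x"
  shows "emap (q \<star> r) = emap (q \<star> r')"
  using mem_emap_generic_mult[OF assms(1-3)] mem_emap_generic_mult[OF assms(1,4,5)]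
  by (intro emap_eqI) simp

text \<open>With limit \<open>\<one>\<close> the extra translation in
  \<open>mem_emap_generic_mult\<close> disappears, so \<open>r\<close> acts as a right identity on
  generic maps.\<close>

lemma emap_generic_mult_one:
  assumes "generic q" "ultra r" "converges r \<one>"
  shows "emap (q \<star> r) = emap q"
  using mem_emap_generic_mult[OF assms] mem_emap_generic[OF assms(1)]
  by (intro emap_eqI) (simp add: converges_carrier)

section \<open>The least left ideal and its idempotents\<close>

definition "M = emap ` {q. generic q}"

lemma left_ideal_M: "left_ideal E M"
  unfolding left_ideal_def
proof (intro conjI ballI)
  obtain q where "generic q"
    using generic_converges[OF one_closed] by blast
  then show "M \<noteq> {}"
    by (auto simp: M_def)
  show "M \<subseteq> carrier E"
    unfolding M_def using emap_in_E generic_ultra by blast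
  fix s i assume "s \<in> carrier E" "i \<in> M"
  then obtain r q where "s = emap r" "ultra r" "i = emap q" "generic q"
    unfolding M_def carrier_E by blast
  then show "s \<otimes>\<^bsub>E\<^esub> i \<in> M"
    using generic_ultra_mult[of r q] by (auto simp: mult_emap generic_ultra M_def)
qed

text \<open>Take \<open>emap r\<close> in \<open>J\<close> with \<open>r\<close> converging to
  \<open>x\<close>, and \<open>s\<close> converging to \<open>inv x\<close>. Then
  \<open>s \<star> r\<close> converges to \<open>\<one>\<close>, so multiplying
  \<open>emap r\<close> on the left by \<open>emap (q \<star> s)\<close> gives back
  \<open>emap q\<close>.\<close>

lemma M_subset_left_ideal:
  assumes "left_ideal E J"
  shows "M \<subseteq> J"
proof
  fix i assume "i \<in> M"
  then obtain q where q: "i = emap q" "generic q"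
    unfolding M_def by blast
  obtain j where j: "j \<in> J" "j \<in> carrier E"
    using assms unfolding left_ideal_def by blast
  then obtain r where r: "j = emap r" "ultra r"
    unfolding carrier_E by blast
  obtain x where x: "converges r x"
    using ultra_converges[OF r(2)] .
  then have xc: "x \<in> carrier H"
    by (rule converges_carrier)
  obtain s where s: "generic s" "converges s (inv x)"
    using generic_converges[of "inv x"] xc by blast
  have us: "ultra s" "ultra q"
    using s q by (simp_all add: generic_ultra)
  have "converges (s \<star> r) \<one>"
    using converges_ultra_mult[OF us(1) s(2) r(2) x] xc by simp
  then have "emap (q \<star> (s \<star> r)) = i"
    using emap_generic_mult_one[OF q(2) ultra_ultra_mult[OF us(1) r(2)]] q(1) by simp
  then have "emap (q \<star> s) \<otimes>\<^bsub>E\<^esub> j = i"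
    using us r by (simp add: mult_emap ultra_ultra_mult star_assoc)
  moreover have "emap (q \<star> s) \<otimes>\<^bsub>E\<^esub> j \<in> J"
    using assms j(1) emap_in_E[OF ultra_ultra_mult[OF us(2,1)]] unfolding left_ideal_def by blast
  ultimately show "i \<in> J"
    by simp
qed

lemma minimal_left_ideal_iff: "minimal_left_ideal E I \<longleftrightarrow> I = M"
  using left_ideal_M M_subset_left_ideal unfolding minimal_left_ideal_def by (metis subset_antisym)

text \<open>A generic ultrafilter with limit \<open>\<one>\<close> is its own right identity, at the
  level of maps.\<close>

lemma idempotent_exists: "\<exists>u. idempotent_in E M u"
proof -
  obtain q where q: "generic q" "converges q \<one>"
    using generic_converges[OF one_closed] by blast
  then have "emap q \<otimes>\<^bsub>E\<^esub> emap q = emap q"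
    by (simp add: mult_emap generic_ultra emap_generic_mult_one)
  then show ?thesis
    using q(1) unfolding idempotent_in_def M_def by blast
qed

section \<open>The normal subgroup\<close>

abbreviation "N \<equiv> N_sub H T G \<A>"

text \<open>The parameter \<open>S\<close> is used twice: with \<open>S = G\<close> the family
  bounds \<open>d_closure\<close>, with \<open>S = carrier H\<close> it bounds
  \<open>C_algebra\<close>.\<close>

definition invariant_sets :: "'a set \<Rightarrow> 'a set \<Rightarrow> 'a set set" where
  "invariant_sets K S = {A. (\<exists>U V. sbp_witness T S A U V) \<and> (\<forall>s\<in>K. rho T A #> s = rho T A)}"

lemma algebra_invariant_sets:
  assumes "dense_subset T S" and K: "K \<subseteq> carrier H"
  shows "Sigma_Algebra.algebra S (invariant_sets K S)"
  unfolding algebra_iff_Int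
proof (intro conjI ballI)
  interpret S: dense_subset T S by fact
  show "invariant_sets K S \<subseteq> Pow S"
    by (auto simp: invariant_sets_def sbp_witness_def)
  have "sbp_witness T S {} {} (topspace T)"
    by (simp add: sbp_witness_def)
  then show "{} \<in> invariant_sets K S"
    by (auto simp: invariant_sets_def rho_def r_coset_def)
  fix A assume "A \<in> invariant_sets K S"
  then obtain U V where w: "sbp_witness T S A U V" and A: "\<And>s. s \<in> K \<Longrightarrow> rho T A #> s = rho T A"
    unfolding invariant_sets_def by blast
  have "rho T (S - A) #> s = rho T (S - A)" if "s \<in> K" for s
  proof -
    have s: "s \<in> carrier H"
      using that K by blast
    show ?thesis
      unfolding S.rho_compl[OF w] topspace_eq
      using s by (simp add: interior_of_r_coset[symmetric] r_coset_Diff rho_carrier A that)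
  qed
  then show "S - A \<in> invariant_sets K S"
    using sbp_witness_compl[OF w] unfolding invariant_sets_def by blast
  fix B assume "B \<in> invariant_sets K S"
  then obtain U' V' where w': "sbp_witness T S B U' V'" and B: "\<And>s. s \<in> K \<Longrightarrow> rho T B #> s = rho T B"
    unfolding invariant_sets_def by blast
  have "rho T (A \<inter> B) #> s = rho T (A \<inter> B)" if "s \<in> K" for s
    using that subsetD[OF K that] by (simp add: S.rho_Int[OF w w'] r_coset_Int rho_carrier A B)
  then show "A \<inter> B \<in> invariant_sets K S"
    using sbp_witness_Int[OF w w'] unfolding invariant_sets_def by blast
qed

text \<open>Moving \<open>s\<close> past \<open>y\<close> replaces it by the conjugate
  \<open>y \<otimes> s \<otimes> inv y\<close>, which is in \<open>K\<close> by normality and is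
  absorbed by \<open>W\<close>.\<close>

lemma r_coset_normal_invariant:
  assumes K: "K \<lhd> H" and W: "W \<subseteq> carrier H" "\<And>s. s \<in> K \<Longrightarrow> W #> s = W" and y: "y \<in> carrier H" and s: "s \<in> K"
  shows "W #> y #> s = W #> y"
proof -
  have sc: "s \<in> carrier H"
    using s normal_imp_subgroup[OF K] subgroup.subset by blast
  have c: "y \<otimes> s \<otimes> inv y \<in> K"
    using normal.inv_op_closed2[OF K y s] .
  have "W #> y #> s = W #> (y \<otimes> s)"
    using W y sc by (simp add: coset_mult_assoc)
  also have "y \<otimes> s = (y \<otimes> s \<otimes> inv y) \<otimes> y"
    using y sc by (simp add: m_assoc)
  also have "W #> \<dots> = W #> (y \<otimes> s \<otimes> inv y) #> y"
    using W y sc by (simp add: coset_mult_assoc)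
  also have "\<dots> = W #> y"
    using W(2)[OF c] by simp
  finally show ?thesis .
qed

text \<open>The invariant sets are one of the families intersected in \<open>d_closure\<close>.
  Closure under \<open>d_op\<close> holds because it only right-translates \<open>rho\<close>, and
  normality of \<open>K\<close> preserves invariance under right translation.\<close>

lemma d_closure_subset_invariant_sets:
  assumes K: "K \<lhd> H" and inv: "\<And>A s. A \<in> \<A> \<Longrightarrow> s \<in> K \<Longrightarrow> rho T A #> s = rho T A"
  shows "d_closure \<G> \<A> \<subseteq> invariant_sets K G"
  unfolding d_closure_def
proof (rule Inter_lower, rule CollectI, intro conjI allI impI ballI)
  have Kc: "K \<subseteq> carrier H"
    using normal_imp_subgroup[OF K] subgroup.subset by blast
  show "\<A> \<subseteq> invariant_sets K G"
  proof
    fix A assume A: "A \<in> \<A>"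
    then show "A \<in> invariant_sets K G"
      using witness[OF A] inv[OF A] unfolding invariant_sets_def by blast
  qed
  have "g <# A \<in> invariant_sets K G" if g: "g \<in> G" and A: "A \<in> invariant_sets K G" for g A
  proof -
    obtain U V where w: "sbp_witness T G A U V" and AI: "\<And>s. s \<in> K \<Longrightarrow> rho T A #> s = rho T A"
      using A unfolding invariant_sets_def by blast
    have gc: "g \<in> carrier H" and Ac: "A \<subseteq> carrier H"
      using g G_subset w by (auto simp: sbp_witness_def)
    have "sbp_witness T G (g <# A) (g <# U) (g <# V)"
      using sbp_witness_l_coset[OF gc w G_subset coset_join3[OF gc subgroup g]] .
    moreover have "rho T (g <# A) #> s = rho T (g <# A)" if "s \<in> K" for s
      using subsetD[OF Kc that] gc Ac AI[OF that] by (simp add: rho_l_coset l_coset_r_coset rho_carrier)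
    ultimately show ?thesis
      unfolding invariant_sets_def by blast
  qed
  then show "G_algebra \<G> (invariant_sets K G)"
    using algebra_invariant_sets[OF dense_subset_axioms Kc] by (simp add: G_algebra_def)
  fix q A assume q: "set_ultrafilter (carrier \<G>) (Pow (carrier \<G>)) q" and A: "A \<in> invariant_sets K G"
  obtain U V where w: "sbp_witness T G A U V" and AI: "\<And>s. s \<in> K \<Longrightarrow> rho T A #> s = rho T A"
    using A unfolding invariant_sets_def by blast
  have uq: "ultra q"
    using q by simp
  then obtain y where y: "converges q y"
    using ultra_converges by blast
  have "inv y \<in> carrier H"
    using converges_carrier[OF y] by simp
  then have "rho T (d_op \<G> q A) #> s = rho T (d_op \<G> q A)" if "s \<in> K" for s
    using r_coset_normal_invariant[OF K rho_carrier AI] that by (simp add: rho_d_op[OF uq y w])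
  then show "d_op \<G> q A \<in> invariant_sets K G"
    using sbp_witness_d_op[OF uq y w] unfolding invariant_sets_def by blast
qed

text \<open>The invariant sets of \<open>H\<close> are one of the families intersected in
  \<open>C_algebra\<close>. Left translations commute with the right action of \<open>K\<close>, and
  right translations are handled by normality.\<close>

lemma C_algebra_subset_invariant_sets:
  assumes K: "K \<lhd> H" and inv: "\<And>A s. A \<in> \<A> \<Longrightarrow> s \<in> K \<Longrightarrow> rho T A #> s = rho T A"
  shows "C_algebra H T G \<A> \<subseteq> invariant_sets K (carrier H)"
  unfolding C_algebra_def
proof (rule Inter_lower, rule CollectI, intro conjI ballI)
  have Kc: "K \<subseteq> carrier H"
    using normal_imp_subgroup[OF K] subgroup.subset by blast
  interpret S: dense_subset T "carrier H"
    by unfold_locales (simp_all flip: topspace_eq)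
  show "Sigma_Algebra.algebra (carrier H) (invariant_sets K (carrier H))"
    by (rule algebra_invariant_sets[OF S.dense_subset_axioms Kc])
  show "{D \<in> SBP T. D \<inter> G \<in> d_closure \<G> \<A>} \<subseteq> invariant_sets K (carrier H)"
  proof clarify
    fix D assume D: "D \<in> SBP T" "D \<inter> G \<in> d_closure \<G> \<A>"
    have "subtopology T (carrier H) = T"
      by (simp flip: topspace_eq)
    then obtain U V where w: "sbp_witness T (carrier H) D U V"
      using S.SBP_witness[of D] D(1) by auto
    then have "sbp_witness T G (D \<inter> G) U V"
      using G_subset by (auto simp: sbp_witness_def)
    \<comment> \<open>\<open>D\<close> and its trace on \<open>G\<close> share the witness
      \<open>V\<close>, which alone determines \<open>rho\<close>.\<close>
    then have "rho T D = rho T (D \<inter> G)"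
      using S.rho_eq[OF w] rho_eq by simp
    moreover have "D \<inter> G \<in> invariant_sets K G"
      using d_closure_subset_invariant_sets[OF K inv] D(2) by blast
    ultimately show "D \<in> invariant_sets K (carrier H)"
      using w unfolding invariant_sets_def by auto
  qed
  fix h C assume h: "h \<in> carrier H" and "C \<in> invariant_sets K (carrier H)"
  then obtain U V where w: "sbp_witness T (carrier H) C U V" and CI: "\<And>s. s \<in> K \<Longrightarrow> rho T C #> s = rho T C"
    unfolding invariant_sets_def by blast
  have Cc: "C \<subseteq> carrier H"
    using w by (simp add: sbp_witness_def)
  have "sbp_witness T (carrier H) (h <# C) (h <# U) (h <# V)"
    using sbp_witness_l_coset[OF h w subset_refl coset_join3[OF h subgroup_self h]] .
  moreover have "rho T (h <# C) #> s = rho T (h <# C)" if "s \<in> K" for s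
    using subsetD[OF Kc that] h Cc CI[OF that] by (simp add: rho_l_coset l_coset_r_coset rho_carrier)
  ultimately show "h <# C \<in> invariant_sets K (carrier H)"
    unfolding invariant_sets_def by blast
  have "rho T (C #> h) #> s = rho T (C #> h)" if "s \<in> K" for s
    using r_coset_normal_invariant[OF K rho_carrier CI h that] h Cc by (simp add: rho_r_coset)
  then show "C #> h \<in> invariant_sets K (carrier H)"
    using sbp_witness_r_coset[OF h w] unfolding invariant_sets_def by blast
qed

text \<open>If \<open>rho T C\<close> is invariant under right translation by \<open>x\<close>, then
  it contains \<open>x\<close> exactly when it contains \<open>\<one>\<close>.\<close>

lemma normal_subset_N:
  assumes K: "K \<lhd> H" and inv: "\<And>A s. A \<in> \<A> \<Longrightarrow> s \<in> K \<Longrightarrow> rho T A #> s = rho T A"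
  shows "K \<subseteq> N"
proof
  fix x assume x: "x \<in> K"
  then have xc: "x \<in> carrier H"
    using normal_imp_subgroup[OF K] subgroup.subset by blast
  have "x \<in> rho T C \<longleftrightarrow> \<one> \<in> rho T C" if "C \<in> C_algebra H T G \<A>" for C
  proof -
    have "rho T C #> x = rho T C"
      using C_algebra_subset_invariant_sets[OF K inv] that x unfolding invariant_sets_def by blast
    then show ?thesis
      using mem_r_coset_iff[of x x "rho T C"] xc rho_carrier by simp
  qed
  then show "x \<in> N"
    using xc by (simp add: N_sub_def sim_rel_def)
qed

text \<open>The relation between \<open>x\<close> and \<open>\<one>\<close> is tested on
  \<open>inv a <# (D #> y)\<close>, where \<open>D\<close> extends \<open>A\<close> to
  \<open>H\<close>. It then compares \<open>a \<otimes> x\<close> with \<open>a\<close> for an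
  arbitrary \<open>a\<close>, which is invariance under \<open>inv x\<close>.\<close>

lemma N_invariant:
  assumes x: "x \<in> N" and A: "A \<in> \<A>" and y: "y \<in> carrier H"
  shows "rho T A #> y #> inv x = rho T A #> y"
proof (rule subset_eqI)
  have xc: "x \<in> carrier H"
    using x by (simp add: N_sub_def)
  obtain U V where w: "sbp_witness T G A U V"
    using witness[OF A] .
  then obtain D where D: "sbp_witness T (carrier H) D U V" "D \<inter> G = A"
    using sbp_witness_extend[OF w] topspace_eq by metis
  interpret S: dense_subset T "carrier H"
    by unfold_locales (simp_all flip: topspace_eq)
  have rho: "rho T D = rho T A"
    using S.rho_eq[OF D(1)] rho_eq[OF w] by simp
  have Dc: "D \<subseteq> carrier H"
    using D(1) by (simp add: sbp_witness_def)
  have Wc: "rho T A #> y \<subseteq> carrier H"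
    using r_coset_subset_G[OF rho_carrier y] .
  then show "rho T A #> y #> inv x \<subseteq> carrier H"
    using r_coset_subset_G xc by simp
  show "rho T A #> y \<subseteq> carrier H"
    by (rule Wc)
  fix a assume a: "a \<in> carrier H"
  have "D \<in> SBP T"
    using sbp_witness_SBP D(1) topspace_eq by metis
  moreover have "A \<in> d_closure \<G> \<A>"
    using A unfolding d_closure_def by blast
  ultimately have "inv a <# (D #> y) \<in> C_algebra H T G \<A>"
    using D(2) y a unfolding C_algebra_def by auto
  then have "x \<in> rho T (inv a <# (D #> y)) \<longleftrightarrow> \<one> \<in> rho T (inv a <# (D #> y))"
    using x by (simp add: N_sub_def sim_rel_def)
  moreover have "rho T (inv a <# (D #> y)) = inv a <# (rho T A #> y)"
    using a y Dc by (simp add: rho_l_coset rho_r_coset rho r_coset_subset_G)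
  ultimately have "a \<otimes> x \<in> rho T A #> y \<longleftrightarrow> a \<in> rho T A #> y"
    using mem_l_coset_iff[of "inv a" x] mem_l_coset_iff[of "inv a" \<one>] Wc a xc by simp
  then show "a \<in> rho T A #> y #> inv x \<longleftrightarrow> a \<in> rho T A #> y"
    using mem_r_coset_iff[of "inv x" a] Wc a xc by simp
qed

text \<open>That \<open>N\<close> is a normal subgroup is a by-product: \<open>N\<close> is shown to
  equal the kernel of the homomorphism \<open>\<Phi>\<close> onto the Ellis group.\<close>

lemma N_normal_and_ellis_group:
  assumes q: "generic q" and idem: "emap (q \<star> q) = emap q"
  shows "N \<lhd> H \<and> ellis_group E M (emap q) \<cong> H Mod N"
proof -
  have uq: "ultra q"
    using q by (rule generic_ultra)
  \<comment> \<open>Idempotence is assumed for the map of \<open>q\<close> only, so the limit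
    \<open>c\<close> need not be the identity and has to be carried along.\<close>
  obtain c where c: "converges q c"
    using ultra_converges[OF uq] .
  then have cc: "c \<in> carrier H"
    by (rule converges_carrier)
  \<comment> \<open>An arbitrary choice; by \<open>emap_generic_mult_cong\<close> the map
    \<open>\<Phi>\<close> does not depend on it.\<close>
  define lim where "lim x = (SOME r. generic r \<and> converges r x)" for x
  have lim_ex: "generic (lim x) \<and> converges (lim x) x" if "x \<in> carrier H" for x
    unfolding lim_def by (rule someI_ex) (use generic_converges[OF that] in blast)
  have lim: "generic (lim x)" "ultra (lim x)" "converges (lim x) x" if "x \<in> carrier H" for x
    using lim_ex[OF that] generic_ultra by simp_all
  define \<Phi> where "\<Phi> x = emap (q \<star> lim x)" for x
  have \<Phi>_eq: "emap (q \<star> r) = \<Phi> x" if "ultra r" "converges r x" for r x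
    unfolding \<Phi>_def using emap_generic_mult_cong[OF q that] lim converges_carrier[OF that(2)] by blast
  have \<Phi>_one: "\<Phi> \<one> = emap q"
    unfolding \<Phi>_def using emap_generic_mult_one[OF q] lim by simp
  \<comment> \<open>In \<open>q \<star> lim x \<star> q \<star> lim y\<close> the inner
    \<open>q\<close> contributes its limit \<open>c\<close>.\<close>
  have \<Phi>_mult_c: "\<Phi> x \<otimes>\<^bsub>E\<^esub> \<Phi> y = \<Phi> (x \<otimes> c \<otimes> y)" if x: "x \<in> carrier H" and y: "y \<in> carrier H" for x y
  proof -
    have "ultra (lim x \<star> q \<star> lim y)" "converges (lim x \<star> q \<star> lim y) (x \<otimes> c \<otimes> y)"
      using lim[OF x] lim[OF y] uq c by (simp_all add: converges_ultra_mult ultra_ultra_mult)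
    then have "emap (q \<star> (lim x \<star> q \<star> lim y)) = \<Phi> (x \<otimes> c \<otimes> y)"
      by (rule \<Phi>_eq)
    then show ?thesis
      unfolding \<Phi>_def using lim(2)[OF x] lim(2)[OF y] uq
      by (simp add: mult_emap ultra_ultra_mult star_assoc)
  qed
  \<comment> \<open>A factor \<open>c\<close> in front comes from a second copy of \<open>q\<close>,
    which idempotence removes.\<close>
  have \<Phi>_c: "\<Phi> (c \<otimes> y) = \<Phi> y" if y: "y \<in> carrier H" for y
  proof -
    have "\<Phi> (c \<otimes> y) = emap (q \<star> (q \<star> lim y))"
      using lim[OF y] uq c by (intro \<Phi>_eq[symmetric] ultra_ultra_mult converges_ultra_mult)
    also have "\<dots> = emap (q \<star> q) \<otimes>\<^bsub>E\<^esub> emap (lim y)"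
      using lim(2)[OF y] uq by (simp add: mult_emap ultra_ultra_mult star_assoc)
    also have "\<dots> = \<Phi> y"
      unfolding idem \<Phi>_def using lim(2)[OF y] uq by (simp add: mult_emap)
    finally show ?thesis .
  qed
  \<comment> \<open>Writing \<open>x = z \<otimes> c\<close> turns
    \<open>x \<otimes> c \<otimes> y\<close> into
    \<open>z \<otimes> c \<otimes> (c \<otimes> y)\<close>. There \<open>\<Phi>_c\<close> drops one
    \<open>c\<close>, and \<open>\<Phi>_mult_c\<close> absorbs the other into
    \<open>z\<close>.\<close>
  have \<Phi>_mult: "\<Phi> (x \<otimes> y) = \<Phi> x \<otimes>\<^bsub>E\<^esub> \<Phi> y" if x: "x \<in> carrier H" and y: "y \<in> carrier H" for x y
  proof -
    define z where "z = x \<otimes> inv c"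
    have z: "z \<in> carrier H" "x = z \<otimes> c"
      using x cc by (simp_all add: z_def m_assoc)
    have "\<Phi> (x \<otimes> c \<otimes> y) = \<Phi> x \<otimes>\<^bsub>E\<^esub> \<Phi> y"
      using \<Phi>_mult_c[OF x y] by simp
    moreover have "\<Phi> (x \<otimes> c \<otimes> y) = \<Phi> z \<otimes>\<^bsub>E\<^esub> \<Phi> (c \<otimes> y)"
      using \<Phi>_mult_c[OF z(1), of "c \<otimes> y"] z cc y by (simp add: m_assoc)
    moreover have "\<Phi> z \<otimes>\<^bsub>E\<^esub> \<Phi> (c \<otimes> y) = \<Phi> (x \<otimes> y)"
      using \<Phi>_mult_c[OF z(1) y] \<Phi>_c[OF y] z(2) by simp
    ultimately show ?thesis
      by simp
  qed
  let ?U = "ellis_group E M (emap q)"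
  have image: "\<Phi> ` carrier H = carrier ?U"
  proof
    show "\<Phi> ` carrier H \<subseteq> carrier ?U"
    proof clarify
      fix x assume x: "x \<in> carrier H"
      have "\<Phi> x = emap q \<otimes>\<^bsub>E\<^esub> emap (lim x)"
        unfolding \<Phi>_def using lim(2)[OF x] uq by (simp add: mult_emap)
      then show "\<Phi> x \<in> carrier ?U"
        using lim(1)[OF x] by (auto simp: ellis_group_def l_coset_def M_def)
    qed
    show "carrier ?U \<subseteq> \<Phi> ` carrier H"
    proof
      fix f assume "f \<in> carrier ?U"
      then obtain t where t: "f = emap q \<otimes>\<^bsub>E\<^esub> emap t" "generic t"
        by (auto simp: ellis_group_def l_coset_def M_def)
      then have ut: "ultra t"
        by (simp add: generic_ultra)
      obtain y where y: "converges t y"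
        using ultra_converges[OF ut] .
      then have "f = \<Phi> y"
        using t(1) \<Phi>_eq[OF ut y] by (simp add: mult_emap uq ut)
      then show "f \<in> \<Phi> ` carrier H"
        using converges_carrier[OF y] by blast
    qed
  qed
  have hom: "\<Phi> \<in> hom H ?U"
    using image \<Phi>_mult by (intro homI) (auto simp: ellis_group_def)
  \<comment> \<open>The image of a homomorphism is a group for the carrier and unit written here,
    and these are those of \<open>?U\<close> already.\<close>
  have "?U\<lparr>carrier := \<Phi> ` carrier H, one := \<Phi> \<one>\<rparr> = ?U"
    using image \<Phi>_one by (simp add: ellis_group_def)
  then have "group ?U"
    using hom_imp_img_group[OF hom] by simp
  then interpret hom: group_hom H ?U \<Phi>
    using hom group_axioms by (simp add: group_hom_def group_hom_axioms_def)
  let ?K = "kernel H ?U \<Phi>"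
  have K_normal: "?K \<lhd> H"
    by (rule hom.normal_kernel)
  have K_iff: "x \<in> ?K \<longleftrightarrow> x \<in> carrier H \<and> \<Phi> x = emap q" for x
    by (simp add: kernel_def ellis_group_def)
  \<comment> \<open>By regularity only inclusion in the closure is at stake. If it fails,
    \<open>V\<close> below is a nonempty open set, a suitable translate of which is in
    \<open>q\<close>; the kernel property then puts a set disjoint from that translate into
    \<open>q\<close> too.\<close>
  have rho_sub: "rho T A #> s \<subseteq> rho T A" if A: "A \<in> \<A>" and s: "s \<in> ?K" for A s
  proof (rule rho_regular)
    let ?W = "rho T A"
    have sc: "s \<in> carrier H"
      using s K_iff by blast
    show "openin T (?W #> s)"
      by (rule openin_r_coset[OF sc openin_rho])
    show "?W #> s \<subseteq> T closure_of ?W"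
    proof (rule ccontr)
      assume neg: "\<not> ?W #> s \<subseteq> T closure_of ?W"
      define V where "V = (?W #> s) - T closure_of ?W"
      have V: "openin T V"
        unfolding V_def by (intro openin_diff openin_r_coset sc openin_rho closedin_closure_of)
      obtain v where v: "v \<in> V"
        using neg unfolding V_def by blast
      have Vc: "V \<subseteq> carrier H"
        using openin_subset[OF V] by (simp add: topspace_eq)
      have vc: "v \<in> carrier H"
        using v Vc by blast
      \<comment> \<open>Chosen so that \<open>V #> inv x\<close> is a neighbourhood of the limit
        \<open>c\<close> of \<open>q\<close>.\<close>
      define x where "x = inv c \<otimes> v"
      have x: "x \<in> carrier H" "c \<otimes> x = v"
        using cc vc by (simp_all add: x_def m_assoc[symmetric])
      have ix: "inv x \<in> carrier H"
        using x by simp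
      have "c \<in> V #> inv x"
        using mem_r_coset_iff[OF ix cc Vc] x v by simp
      then have Vq: "(V #> inv x) \<inter> G \<in> q"
        using convergesD[OF c openin_r_coset[OF ix V]] by simp
      have "V #> inv x \<subseteq> ?W #> s #> inv x"
        by (auto simp: V_def r_coset_def)
      then have "(?W #> s #> inv x) \<inter> G \<in> q"
        by (intro ultrafilter_mono[OF uq Vq]) blast+
      \<comment> \<open>The shape required by \<open>mem_emap_generic_mult\<close> for the limits
        \<open>x \<otimes> inv s\<close> and \<open>\<one>\<close>. The set in \<open>q\<close>
        becomes a statement about the value of \<open>\<Phi> (x \<otimes> inv s)\<close> at the
        point given by \<open>lim \<one>\<close>.\<close>
      moreover have "?W #> s #> inv x = ?W #> (inv \<one> \<otimes> inv (x \<otimes> inv s))"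
        using x(1) sc by (simp add: coset_mult_assoc rho_carrier inv_mult_group)
      moreover have l1: "ultra (lim \<one>)" "converges (lim \<one>) \<one>"
        using lim by simp_all
      have xs: "x \<otimes> inv s \<in> carrier H"
        using x sc by simp
      ultimately have "d_op \<G> (lim \<one>) A \<in> q \<star> lim (x \<otimes> inv s)"
        using mem_emap_generic_mult[OF q lim(2,3)[OF xs] l1 A] by simp
      then have "A \<in> \<Phi> (x \<otimes> inv s) (\<A> \<inter> lim \<one>)"
        unfolding \<Phi>_def mem_emap_iff[OF l1(1) A] .
      moreover have "\<Phi> (x \<otimes> inv s) = \<Phi> x"
      proof -
        have "inv s \<in> ?K"
          using subgroup.m_inv_closed[OF hom.subgroup_kernel s] .
        then have "\<Phi> (inv s) = \<Phi> \<one>"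
          using K_iff \<Phi>_one by simp
        then show ?thesis
          using \<Phi>_mult[OF x(1), of "inv s"] \<Phi>_mult[OF x(1), of \<one>] x(1) sc by simp
      qed
      ultimately have "A \<in> emap (q \<star> lim x) (\<A> \<inter> lim \<one>)"
        by (simp add: \<Phi>_def)
      then have "(?W #> inv x) \<inter> G \<in> q"
        using mem_emap_generic_mult[OF q lim(2,3)[OF x(1)] l1 A] mem_emap_iff[OF l1(1) A] x(1) by simp
      from ultrafilter_disjoint[OF uq this Vq] obtain g where g: "g \<in> ?W #> inv x" "g \<in> V #> inv x" "g \<in> G"
        by blast
      have gc: "g \<in> carrier H"
        using g(3) G_subset by blast
      have "g \<otimes> x \<in> ?W" "g \<otimes> x \<in> V"
        using g(1,2) mem_r_coset_iff[OF ix gc Vc] mem_r_coset_iff[OF ix gc rho_carrier, of A] x(1) by simp_all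
      then show False
        using closure_of_subset[OF rho_subset, of T A] unfolding V_def by blast
    qed
  qed
  \<comment> \<open>The converse inclusion is \<open>rho_sub\<close> for \<open>inv s\<close>,
    translated by \<open>s\<close>.\<close>
  have rho_inv: "rho T A #> s = rho T A" if A: "A \<in> \<A>" and s: "s \<in> ?K" for A s
  proof
    have sc: "s \<in> carrier H"
      using s K_iff by blast
    have "inv s \<in> ?K"
      using subgroup.m_inv_closed[OF hom.subgroup_kernel s] .
    then have "rho T A #> inv s #> s \<subseteq> rho T A #> s"
      using rho_sub[OF A] by (auto simp: r_coset_def)
    then show "rho T A \<subseteq> rho T A #> s"
      using sc by (simp add: coset_mult_assoc rho_carrier)
  qed (rule rho_sub[OF A s])
  \<comment> \<open>By \<open>N_invariant\<close> the extra factor \<open>inv x\<close> in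
    \<open>mem_emap_generic_mult\<close> has no effect, so \<open>q \<star> lim x\<close> and
    \<open>q\<close> define the same map.\<close>
  have "N \<subseteq> ?K"
  proof
    fix x assume x: "x \<in> N"
    then have xc: "x \<in> carrier H"
      by (simp add: N_sub_def)
    have "emap (q \<star> lim x) = emap q"
    proof (rule emap_eqI)
      fix s y A assume s: "ultra s" "converges s y" and A: "A \<in> \<A>"
      have y: "inv y \<in> carrier H"
        using converges_carrier[OF s(2)] by simp
      have "rho T A #> (inv y \<otimes> inv x) = rho T A #> inv y"
        using N_invariant[OF x A y] xc y by (simp add: coset_mult_assoc rho_carrier)
      then show "d_op \<G> s A \<in> q \<star> lim x \<longleftrightarrow> d_op \<G> s A \<in> q"
        using mem_emap_generic_mult[OF q lim(2,3)[OF xc] s A] mem_emap_generic[OF q s A] by simp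
    qed
    then show "x \<in> ?K"
      using xc by (simp add: K_iff \<Phi>_def)
  qed
  then have "?K = N"
    using normal_subset_N[OF K_normal rho_inv] by blast
  moreover have "?U \<cong> H Mod ?K"
    using group.iso_sym[OF normal.factorgroup_is_group[OF K_normal] hom.FactGroup_iso[OF image]] .
  ultimately show ?thesis
    using K_normal by simp
qed

end

theorem theorem4p29:
  fixes H :: "('a, 'm) monoid_scheme" and T :: "'a topology"
    and G :: "'a set" and \<A> :: "'a set set"
  defines "\<G> \<equiv> H\<lparr>carrier := G\<rparr>"
  defines "E \<equiv> ellis_semigroup \<G> (stone_space G \<A>) (stone_action \<G>)"
  assumes "topological_group H T" and "compact_space T"
    and "subgroup G H" and "T closure_of G = topspace T"
    and "totally_bounded_group \<G> (subtopology T G)"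
    and "G_algebra \<G> \<A>" and "\<A> \<subseteq> SBP (subtopology T G)"
  shows "N_sub H T G \<A> \<lhd> H \<and>
    (\<exists>I u. minimal_left_ideal E I \<and> idempotent_in E I u) \<and>
    (\<forall>I u. minimal_left_ideal E I \<and> idempotent_in E I u \<longrightarrow>
           ellis_group E I u \<cong> H Mod N_sub H T G \<A>)"
proof -
  interpret sbp_algebra H T G \<A>
    using assms unfolding sbp_algebra_def sbp_algebra_axioms_def compact_dense_subgroup_def
      compact_dense_subgroup_axioms_def by simp
  have E: "E = ellis_semigroup (H\<lparr>carrier := G\<rparr>) (stone_space G \<A>) (stone_action (H\<lparr>carrier := G\<rparr>))"
    by (simp add: E_def \<G>_def)
  have main: "N_sub H T G \<A> \<lhd> H \<and> ellis_group E M u \<cong> H Mod N_sub H T G \<A>" if u: "idempotent_in E M u" for u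
  proof -
    obtain q where q: "u = ellis_map (H\<lparr>carrier := G\<rparr>) \<A> q" "generic q"
      using u unfolding idempotent_in_def M_def by blast
    then have "ellis_map (H\<lparr>carrier := G\<rparr>) \<A> (ultra_mult (H\<lparr>carrier := G\<rparr>) q q) = ellis_map (H\<lparr>carrier := G\<rparr>) \<A> q"
      using u mult_emap[of q q] generic_ultra[OF q(2)] unfolding idempotent_in_def E by simp
    then show ?thesis
      using N_normal_and_ellis_group[OF q(2)] unfolding q(1) E by simp
  qed
  \<comment> \<open>\<open>main\<close> delivers normality only in the presence of an idempotent, so
    one is produced first; it also settles the existence claim.\<close>
  obtain u where "idempotent_in E M u"
    using idempotent_exists unfolding E by (rule exE)
  then show ?thesis
    using main unfolding E minimal_left_ideal_iff by auto
qed

end
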